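(* Consider a latency-aware contextual bandit problem $\mathcal{M}=(P_{\mathrm{env}},\psi_* )$ as defined in the context. Let $(\mathbb{X},\mathbb{A},l)\sim P_{\mathrm{env}}$ with $\mathbb{X}=\{x_1,\dots,x_n\}$, and let $\boldsymbol\mu=\{\mu_i\}_{i=1}^n$ with $\mu_i=\psi_*(x_i)$. For $\Gamma\in\mathbb{R}$ and $A\in\mathbb{A}$ define $$g(\Gamma,A,l,\boldsymbol\mu)=l(A)\,\Gamma-\sum_{i\in A}\mu_i .$$ Then the optimal average reward $\Gamma=\Gamma^*_{\mathcal{M}}$ is the unique solution $\Gamma\in\mathbb{R}$ of $$\mathbb{E}\Big[\min_{A\in\mathbb{A}} g(\Gamma,A,l,\boldsymbol\mu)\Big]=0 .$$
   Context: Latency-aware contextual bandit. At each round $j=1,2,\dots$ the learner observes a triple $(\mathbb{X}_j,\mathbb{A}_j,l_j)$: arm feature vectors $\mathbb{X}_j=\{x_{j,1},\dots,x_{j,n_j}\}\subset\mathbb{R}^d$ (with $n_j$ random), a nonempty action space $\mathbb{A}_j\subseteq 2^{[n_j]}$ of subsets of arms, and a latency function $l_j:\mathbb{A}_j\to\mathbb{R}_{\ge 0}$. The triples are i.i.d. over $j$ with law $P_{\mathrm{env}}$; dependence within a triple is arbitrary. The learner picks $A_j\in\mathbb{A}_j$, observes $y_{j,i}=\psi_*(x_{j,i})+\epsilon_{j,i}$ for each $i\in A_j$ only, where $\psi_*:\mathbb{R}^d\to[-1,1]$ is the mean reward function and $\epsilon_{j,i}$ is zero-mean noise, and the round takes time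 $l_j(A_j)$. Write $\mu_{j,i}=\psi_*(x_{j,i})$. Boundedness assumption: there are constants $n_{\max},l_{\min},l_{\max}>0$ such that for all $j$, $n_j\le n_{\max}$ and $l_j(A)\in[l_{\min},l_{\max}]$ for all $A\in\mathbb{A}_j$. A policy $\pi$ maps, at each round $k$, the history $\mathcal{H}_{k-1}=\{(\mathbb{X}_j,\mathbb{A}_j,l_j,\{y_{j,i}\}_{i\in A_j})\}_{j=1}^{k-1}$ and the current observation $(\mathbb{X}_k,\mathbb{A}_k,l_k)$ to a probability distribution on $\mathbb{A}_k$, from which $A_k$ is drawn. Let $k(t)$ be the (random) number of rounds completed by time $t$, i.e. the largest $k$ with $\sum_{j=1}^k l_j(A_j)\le t$. Set $$q^\pi(t)=\sum_{j=1}^{k(t)}\sum_{i\in A_j}\psi_*(x_{j,i}),$$ so that $\mathbb{E}[q^\pi(t)]$ is the expected cumulative reward up to time $t$. Define the long-term average reward $\Gamma^\pi_{\mathcal{M}}=\limsup_{t\to\infty}\mathbb{E}[q^\pi(t)]/t$ and the optimal average reward $\Gamma^*_{\mathcal{M}}=\sup_\pi\Gamma^\pi_{\mathcal{M}}$. *)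

theory Defs
  imports "HOL-Probability.Probability"
begin

section \<open>Contexts\<close>

text \<open>
  A context is the triple observed at the start of a round. The arm feature vectors are given as
  the number \<open>n\<close> of arms together with a family indexed by \<open>{1..n}\<close>, so the tuple is
  \<open>(n, x, \<A>, l)\<close>. Actions are sets of arm indices.
\<close>

type_synonym 'd ctx = "nat \<times> (nat \<Rightarrow> real^'d) \<times> nat set set \<times> (nat set \<Rightarrow> real)"

abbreviation num_arms :: "'d::finite ctx \<Rightarrow> nat" where
  "num_arms c \<equiv> fst c"

abbreviation feature :: "'d::finite ctx \<Rightarrow> nat \<Rightarrow> real^'d" where
  "feature c \<equiv> fst (snd c)"

abbreviation actions :: "'d::finite ctx \<Rightarrow> nat set set" where
  "actions c \<equiv> fst (snd (snd c))"

abbreviation latency :: "'d::finite ctx \<Rightarrow> nat set \<Rightarrow> real" where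
  "latency c \<equiv> snd (snd (snd c))"

text \<open>
  Features and latencies are extensional functions on their actual domains (arms, resp. available
  actions), so that a context carries no information beyond the triple itself.
\<close>

definition valid_ctx :: "'d::finite ctx \<Rightarrow> bool" where
  "valid_ctx c \<longleftrightarrow>
     feature c \<in> {1..num_arms c} \<rightarrow>\<^sub>E UNIV \<and>
     actions c \<noteq> {} \<and> actions c \<subseteq> Pow {1..num_arms c} \<and>
     latency c \<in> actions c \<rightarrow>\<^sub>E {0..}"

text \<open>\<open>Fpow UNIV\<close> is the countable set of all finite sets of naturals.\<close>

definition action_space :: "nat set measure" where
  "action_space = count_space (Fpow UNIV)"

definition ctx_space :: "'d::finite ctx measure" where
  "ctx_space = restrict_space
     (count_space UNIV \<Otimes>\<^sub>M (\<Pi>\<^sub>M i\<in>UNIV. borel) \<Otimes>\<^sub>M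
      count_space (Fpow (Fpow UNIV)) \<Otimes>\<^sub>M (\<Pi>\<^sub>M A\<in>Fpow UNIV. borel))
     {c. valid_ctx c}"

definition mean_reward :: "(real^'d \<Rightarrow> real) \<Rightarrow> 'd::finite ctx \<Rightarrow> nat \<Rightarrow> real" where
  "mean_reward \<psi> c = (\<lambda>i. \<psi> (feature c i))"


section \<open>Rounds, noise and histories\<close>

text \<open>
  A round consists of the context, the chosen action and the noise. Rounds are numbered from \<open>0\<close>.
  The coordinates of the noise vector outside the chosen action are never observed.
\<close>

type_synonym 'd round = "'d ctx \<times> nat set \<times> (nat \<Rightarrow> real)"

definition noise_space :: "(nat \<Rightarrow> real) measure" where
  "noise_space = (\<Pi>\<^sub>M i\<in>UNIV. borel)"

definition round_space :: "'d::finite round measure" where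
  "round_space = ctx_space \<Otimes>\<^sub>M action_space \<Otimes>\<^sub>M noise_space"

text \<open>
  \<open>\<eta> k \<omega> c A\<close> is the conditional law of the noise vector of round \<open>k\<close> given all previous rounds
  \<open>\<omega>\<close>, the context \<open>c\<close> and the action \<open>A\<close> of round \<open>k\<close>. Independent noise is the special case
  where \<open>\<eta>\<close> does not depend on its arguments.
\<close>

type_synonym 'd noise =
  "nat \<Rightarrow> (nat \<Rightarrow> 'd round) \<Rightarrow> 'd ctx \<Rightarrow> nat set \<Rightarrow> (nat \<Rightarrow> real) measure"

definition zero_mean_noise :: "'d::finite noise \<Rightarrow> bool" where
  "zero_mean_noise \<eta> \<longleftrightarrow>
     (\<forall>k. (\<lambda>(\<omega>, c, A). \<eta> k \<omega> c A) \<in>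
       (\<Pi>\<^sub>M j\<in>{0..<k}. round_space) \<Otimes>\<^sub>M ctx_space \<Otimes>\<^sub>M action_space \<rightarrow>\<^sub>M prob_algebra noise_space) \<and>
     (\<forall>k. \<forall>\<omega>\<in>space (\<Pi>\<^sub>M j\<in>{0..<k}. round_space). \<forall>c\<in>space ctx_space. \<forall>A\<in>actions c. \<forall>i\<in>A.
       integrable (\<eta> k \<omega> c A) (\<lambda>e. e i) \<and> (\<integral>e. e i \<partial>\<eta> k \<omega> c A) = 0)"

text \<open>
  The learner observes the rewards of the chosen arms only. The third component of an observation
  is a reward vector with domain the chosen action.
\<close>

type_synonym 'd obs = "'d ctx \<times> nat set \<times> (nat \<Rightarrow> real)"

definition obs_space :: "'d::finite obs measure" where
  "obs_space = ctx_space \<Otimes>\<^sub>M action_space \<Otimes>\<^sub>M (\<Pi>\<^sub>M i\<in>UNIV. borel)"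

definition observe :: "(real^'d \<Rightarrow> real) \<Rightarrow> 'd::finite round \<Rightarrow> 'd obs" where
  "observe \<psi> = (\<lambda>(c, A, e). (c, A, \<lambda>i\<in>A. mean_reward \<psi> c i + e i))"

definition history :: "(real^'d \<Rightarrow> real) \<Rightarrow> nat \<Rightarrow> (nat \<Rightarrow> 'd::finite round) \<Rightarrow> nat \<Rightarrow> 'd obs" where
  "history \<psi> k \<omega> = (\<lambda>j\<in>{0..<k}. observe \<psi> (\<omega> j))"

definition history_space :: "nat \<Rightarrow> (nat \<Rightarrow> 'd::finite obs) measure" where
  "history_space k = (\<Pi>\<^sub>M j\<in>{0..<k}. obs_space)"


section \<open>Policies and the law of the interaction\<close>

type_synonym 'd policy = "nat \<Rightarrow> (nat \<Rightarrow> 'd obs) \<Rightarrow> 'd ctx \<Rightarrow> nat set measure"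

definition policies :: "'d::finite policy set" where
  "policies = {\<pi>.
     (\<forall>k. (\<lambda>(h, c). \<pi> k h c) \<in> history_space k \<Otimes>\<^sub>M ctx_space \<rightarrow>\<^sub>M prob_algebra action_space) \<and>
     (\<forall>k. \<forall>h\<in>space (history_space k). \<forall>c\<in>space ctx_space. AE A in \<pi> k h c. A \<in> actions c)}"

text \<open>
  Conditional law of round \<open>k\<close> given the previous rounds \<open>\<omega>\<close>. The context is always drawn
  from \<open>P\<close>, independently of the past, which makes the contexts i.i.d.
\<close>

definition round_kernel ::
  "'d ctx measure \<Rightarrow> (real^'d \<Rightarrow> real) \<Rightarrow> 'd noise \<Rightarrow> 'd policy \<Rightarrow> nat \<Rightarrow>
   (nat \<Rightarrow> 'd::finite round) \<Rightarrow> 'd round measure" where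
  "round_kernel P \<psi> \<eta> \<pi> k \<omega> =
     P \<bind> (\<lambda>c. \<pi> k (history \<psi> k \<omega>) c \<bind> (\<lambda>A. \<eta> k \<omega> c A \<bind> (\<lambda>e. return round_space (c, A, e))))"

text \<open>The Ionescu-Tulcea measure on infinite sequences of rounds with these transition kernels.\<close>

definition trajectory ::
  "'d ctx measure \<Rightarrow> (real^'d \<Rightarrow> real) \<Rightarrow> 'd noise \<Rightarrow> 'd policy \<Rightarrow> (nat \<Rightarrow> 'd::finite round) measure" where
  "trajectory P \<psi> \<eta> \<pi> =
     projective_family.lim UNIV
       (Ionescu_Tulcea.CI (round_kernel P \<psi> \<eta> \<pi>) (\<lambda>_. round_space)) (\<lambda>_. round_space)"


section \<open>Average reward\<close>

definition round_latency :: "'d::finite round \<Rightarrow> real" where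
  "round_latency = (\<lambda>(c, A, e). latency c A)"

definition round_reward :: "(real^'d \<Rightarrow> real) \<Rightarrow> 'd::finite round \<Rightarrow> real" where
  "round_reward \<psi> = (\<lambda>(c, A, e). \<Sum>i\<in>A. mean_reward \<psi> c i)"

definition rounds_completed :: "(nat \<Rightarrow> 'd::finite round) \<Rightarrow> real \<Rightarrow> nat" where
  "rounds_completed \<omega> t = (GREATEST k. (\<Sum>j<k. round_latency (\<omega> j)) \<le> t)"

definition cumulative_reward ::
  "(real^'d \<Rightarrow> real) \<Rightarrow> (nat \<Rightarrow> 'd::finite round) \<Rightarrow> real \<Rightarrow> real" where
  "cumulative_reward \<psi> \<omega> t = (\<Sum>j<rounds_completed \<omega> t. round_reward \<psi> (\<omega> j))"

definition average_reward ::
  "'d ctx measure \<Rightarrow> (real^'d \<Rightarrow> real) \<Rightarrow> 'd noise \<Rightarrow> 'd::finite policy \<Rightarrow> ereal" where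
  "average_reward P \<psi> \<eta> \<pi> =
     Limsup at_top (\<lambda>t. ereal ((\<integral>\<omega>. cumulative_reward \<psi> \<omega> t \<partial>trajectory P \<psi> \<eta> \<pi>) / t))"

definition optimal_average_reward ::
  "'d ctx measure \<Rightarrow> (real^'d \<Rightarrow> real) \<Rightarrow> 'd::finite noise \<Rightarrow> ereal" where
  "optimal_average_reward P \<psi> \<eta> = (SUP \<pi>\<in>policies. average_reward P \<psi> \<eta> \<pi>)"

definition g_fun :: "real \<Rightarrow> nat set \<Rightarrow> (nat set \<Rightarrow> real) \<Rightarrow> (nat \<Rightarrow> real) \<Rightarrow> real" where
  "g_fun \<Gamma> A l \<mu> = l A * \<Gamma> - (\<Sum>i\<in>A. \<mu> i)"


section \<open>The bandit problem\<close>

locale latency_bandit = prob_space P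
  for P :: "'d::finite ctx measure" +
  fixes \<psi> :: "real^'d \<Rightarrow> real"
    and \<eta> :: "'d noise"
    and n_max :: nat
    and l_min l_max :: real
  assumes sets_P [measurable_cong]: "sets P = sets ctx_space"
    and \<psi>_measurable [measurable]: "\<psi> \<in> borel_measurable borel"
    and \<psi>_range: "\<psi> x \<in> {-1..1}"
    and noise: "zero_mean_noise \<eta>"
    and bounds_pos: "0 < n_max" "0 < l_min" "0 < l_max"
    and bounded: "AE c in P. num_arms c \<le> n_max \<and> (\<forall>A\<in>actions c. latency c A \<in> {l_min..l_max})"


section \<open>Well-definedness\<close>

lemma space_action_space[simp]: "space action_space = Fpow UNIV" by (simp add: action_space_def)

lemma measurable_num_arms[measurable]: "num_arms \<in> ctx_space \<rightarrow>\<^sub>M count_space UNIV"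
  unfolding ctx_space_def by (rule measurable_restrict_space1) measurable

lemma measurable_feature[measurable]: "(\<lambda>c. feature c i) \<in> ctx_space \<rightarrow>\<^sub>M borel"
  unfolding ctx_space_def by (rule measurable_restrict_space1) measurable

lemma measurable_actions[measurable]: "actions \<in> ctx_space \<rightarrow>\<^sub>M count_space (Fpow (Fpow UNIV))"
  unfolding ctx_space_def by (rule measurable_restrict_space1) measurable

lemma measurable_latency_fixed: assumes "A \<in> Fpow UNIV" shows "(\<lambda>c. latency c A) \<in> ctx_space \<rightarrow>\<^sub>M borel"
  using assms unfolding ctx_space_def by (intro measurable_restrict_space1) measurable

lemma space_ctx_spaceD: "c \<in> space ctx_space \<Longrightarrow> valid_ctx c"
  by (auto simp: ctx_space_def space_restrict_space)

lemma measurable_latency[measurable]: 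
  assumes [measurable]: "f \<in> M \<rightarrow>\<^sub>M ctx_space" "h \<in> M \<rightarrow>\<^sub>M action_space"
  shows "(\<lambda>x. latency (f x) (h x)) \<in> M \<rightarrow>\<^sub>M borel"
  by (rule measurable_compose_countable'[where I="Fpow UNIV" and g=h])
     (use assms measurable_compose[OF assms(1) measurable_latency_fixed] in \<open>auto simp: countable_Fpow action_space_def\<close>)

lemma measurable_mean_reward[measurable]: 
  assumes [measurable]: "\<psi> \<in> borel_measurable borel"
  shows "(\<lambda>c. mean_reward \<psi> c i) \<in> ctx_space \<rightarrow>\<^sub>M borel"
  unfolding mean_reward_def by measurable

lemma measurable_observe[measurable]:
  assumes [measurable]: "\<psi> \<in> borel_measurable borel"
  shows "observe \<psi> \<in> round_space \<rightarrow>\<^sub>M obs_space"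
proof -
  have 1: "(\<lambda>x. restrict (\<lambda>i. mean_reward \<psi> (fst x) i + snd (snd x) i) (fst (snd x)))
     \<in> round_space \<rightarrow>\<^sub>M (\<Pi>\<^sub>M i\<in>UNIV. borel)"
  proof (rule measurable_PiM_single')
    fix i :: nat
    have [measurable]: "Measurable.pred action_space (\<lambda>A. i \<in> A)"
      by (simp add: action_space_def)
    have [measurable]: "(\<lambda>e. e i) \<in> noise_space \<rightarrow>\<^sub>M borel" unfolding noise_space_def by measurable
    have "(\<lambda>x. if i \<in> fst (snd x) then mean_reward \<psi> (fst x) i + snd (snd x) i else undefined) \<in> round_space \<rightarrow>\<^sub>M borel"
      unfolding round_space_def by measurable
    then show "(\<lambda>x. restrict (\<lambda>i. mean_reward \<psi> (fst x) i + snd (snd x) i) (fst (snd x)) i) \<in> round_space \<rightarrow>\<^sub>M borel"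
      by (simp add: restrict_def)
  qed auto
  show ?thesis
    unfolding observe_def obs_space_def case_prod_beta
    by (intro measurable_Pair 1) (auto simp: round_space_def)
qed

lemma measurable_history[measurable]:
  assumes [measurable]: "\<psi> \<in> borel_measurable borel"
  shows "history \<psi> k \<in> (\<Pi>\<^sub>M j\<in>{0..<k}. round_space) \<rightarrow>\<^sub>M history_space k"
  unfolding history_def history_space_def by measurable

lemma policies_nonempty: "(policies :: 'd::finite policy set) \<noteq> {}"
proof -
  let ?\<pi> = "\<lambda>k h (c :: 'd ctx). return action_space (SOME A. A \<in> actions c)"
  have some: "(SOME A. A \<in> actions c) \<in> actions c" "(SOME A. A \<in> actions c) \<in> Fpow UNIV"
    if "c \<in> space ctx_space" for c :: "'d ctx"
  proof -
    have "actions c \<noteq> {}" "actions c \<in> Fpow (Fpow UNIV)"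
      using space_ctx_spaceD[OF that] measurable_space[OF measurable_actions that]
      by (auto simp: valid_ctx_def)
    then show "(SOME A. A \<in> actions c) \<in> actions c" "(SOME A. A \<in> actions c) \<in> Fpow UNIV"
      using some_in_eq[of "actions c"] by (auto simp: Fpow_def)
  qed
  have sel: "(\<lambda>c :: 'd ctx. SOME A. A \<in> actions c) \<in> ctx_space \<rightarrow>\<^sub>M action_space"
  proof -
    have "(\<lambda>c :: 'd ctx. SOME A. A \<in> actions c) \<in> ctx_space \<rightarrow>\<^sub>M count_space UNIV"
      by (rule measurable_compose[OF measurable_actions]) simp
    from measurable_restrict_space2[OF _ this, of "Fpow UNIV"] show ?thesis
      using some(2) by (auto simp: action_space_def restrict_count_space)
  qed
  have "?\<pi> \<in> policies"
    unfolding policies_def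
  proof (intro CollectI conjI allI ballI)
    show "(\<lambda>(h, c). ?\<pi> k h c) \<in> history_space k \<Otimes>\<^sub>M ctx_space \<rightarrow>\<^sub>M prob_algebra action_space" for k
      unfolding split_beta'
      by (rule measurable_compose[OF _ measurable_return_prob_space])
         (rule measurable_compose[OF measurable_snd sel])
    show "AE A in ?\<pi> k h c. A \<in> actions c" if "c \<in> space ctx_space" for k and h :: "nat \<Rightarrow> 'd obs" and c :: "'d ctx"
      using some[OF that] by (subst AE_return) (auto simp: action_space_def)
  qed
  then show ?thesis by blast
qed

context latency_bandit begin

lemma measurable_round_kernel:
  fixes \<pi> :: "'d policy"
  assumes pi: "\<pi> \<in> policies"
  shows "round_kernel P \<psi> \<eta> \<pi> k \<in> (\<Pi>\<^sub>M j\<in>{0..<k}. round_space) \<rightarrow>\<^sub>M prob_algebra round_space"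
proof -
  let ?H = "\<Pi>\<^sub>M j\<in>{0..<k}. (round_space :: 'd round measure)"
  have p: "(\<lambda>(h, c). \<pi> k h c) \<in> history_space k \<Otimes>\<^sub>M ctx_space \<rightarrow>\<^sub>M prob_algebra action_space"
    using pi by (auto simp: policies_def)
  have n: "(\<lambda>(\<omega>, c, A). \<eta> k \<omega> c A) \<in> ?H \<Otimes>\<^sub>M ctx_space \<Otimes>\<^sub>M action_space \<rightarrow>\<^sub>M prob_algebra noise_space"
    using noise by (auto simp: zero_mean_noise_def)
  have PP: "P \<in> space (prob_algebra ctx_space)"
    by (simp add: space_prob_algebra sets_P prob_space_axioms)
  have [measurable]: "(\<lambda>x. P) \<in> ?H \<rightarrow>\<^sub>M prob_algebra ctx_space"
    using PP by simp
  have [measurable]: "(\<lambda>x. \<pi> k (history \<psi> k (fst x)) (snd x)) \<in> ?H \<Otimes>\<^sub>M ctx_space \<rightarrow>\<^sub>M prob_algebra action_space"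
    using measurable_compose[OF _ p, of "\<lambda>x. (history \<psi> k (fst x), snd x)"] by simp
  have [measurable]: "(\<lambda>x. \<eta> k (fst (fst x)) (snd (fst x)) (snd x)) \<in> (?H \<Otimes>\<^sub>M ctx_space) \<Otimes>\<^sub>M action_space \<rightarrow>\<^sub>M prob_algebra noise_space"
    using measurable_compose[OF _ n, of "\<lambda>x. (fst (fst x), snd (fst x), snd x)"] by simp
  have r: "(\<lambda>x. return round_space (snd (fst (fst x)), snd (fst x), snd x)) \<in>
      ((?H \<Otimes>\<^sub>M ctx_space) \<Otimes>\<^sub>M action_space) \<Otimes>\<^sub>M noise_space \<rightarrow>\<^sub>M prob_algebra round_space"
    by (rule measurable_compose[OF _ measurable_return_prob_space]) (simp add: round_space_def)
  have "(\<lambda>x. \<eta> k (fst (fst x)) (snd (fst x)) (snd x) \<bind> (\<lambda>e. return round_space (snd (fst x), snd x, e)))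
      \<in> (?H \<Otimes>\<^sub>M ctx_space) \<Otimes>\<^sub>M action_space \<rightarrow>\<^sub>M prob_algebra round_space"
    by (rule measurable_bind_prob_space2[where N=noise_space]) (use r in \<open>simp_all add: split_beta'\<close>)
  then have "(\<lambda>x. \<pi> k (history \<psi> k (fst x)) (snd x) \<bind> (\<lambda>A. \<eta> k (fst x) (snd x) A \<bind>
      (\<lambda>e. return round_space (snd x, A, e)))) \<in> ?H \<Otimes>\<^sub>M ctx_space \<rightarrow>\<^sub>M prob_algebra round_space"
    by (intro measurable_bind_prob_space2[where N=action_space]) (simp_all add: split_beta')
  then show ?thesis
    unfolding round_kernel_def
    by (intro measurable_bind_prob_space2[where N=ctx_space]) (simp_all add: split_beta')
qed

lemma Ionescu_Tulcea_round_kernel: assumes "\<pi> \<in> policies"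
  shows "Ionescu_Tulcea (round_kernel P \<psi> \<eta> \<pi>) (\<lambda>_. round_space)"
proof (rule Ionescu_Tulcea.intro)
  show "round_kernel P \<psi> \<eta> \<pi> i \<in> (\<Pi>\<^sub>M j\<in>{0..<i}. round_space) \<rightarrow>\<^sub>M subprob_algebra round_space" for i
    using measurable_prob_algebraD[OF measurable_round_kernel[OF assms]] .
  show "prob_space (round_kernel P \<psi> \<eta> \<pi> i x)" if "x \<in> space (\<Pi>\<^sub>M j\<in>{0..<i}. round_space)" for i x
    using measurable_space[OF measurable_round_kernel[OF assms] that] by (simp add: space_prob_algebra)
qed

lemma measurable_min_g: "(\<lambda>c. MIN A\<in>actions c. g_fun \<Gamma> A (latency c) (mean_reward \<psi> c)) \<in> borel_measurable P"
proof (rule measurable_compose_countable'[where I="Fpow (Fpow UNIV)" and g=actions])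
  show "actions \<in> P \<rightarrow>\<^sub>M count_space (Fpow (Fpow UNIV))" by measurable
  show "countable (Fpow (Fpow (UNIV::nat set)))" by (simp add: countable_Fpow)
  fix AA :: "nat set set" assume AA: "AA \<in> Fpow (Fpow UNIV)"
  have [measurable]: "(\<lambda>c. latency c A) \<in> borel_measurable P" if "A \<in> AA" for A
    using measurable_latency_fixed[of A] AA that by (auto simp: Fpow_def sets_P cong: measurable_cong_sets)
  show "(\<lambda>c. MIN A\<in>AA. g_fun \<Gamma> A (latency c) (mean_reward \<psi> c)) \<in> borel_measurable P"
    using AA by (intro borel_measurable_Min) (auto simp: g_fun_def Fpow_def)
qed

lemma integrable_min_g: "integrable P (\<lambda>c. MIN A\<in>actions c. g_fun \<Gamma> A (latency c) (mean_reward \<psi> c))"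
proof (rule integrable_const_bound[where B="l_max * \<bar>\<Gamma>\<bar> + n_max", OF _ measurable_min_g])
  have "AE c in P. valid_ctx c" using space_ctx_spaceD sets_eq_imp_space_eq[OF sets_P] by (auto intro!: AE_I2)
  with bounded show "AE c in P. norm (MIN A\<in>actions c. g_fun \<Gamma> A (latency c) (mean_reward \<psi> c)) \<le> l_max * \<bar>\<Gamma>\<bar> + n_max"
  proof eventually_elim
    case (elim c)
    have fin: "finite (actions c)" "actions c \<noteq> {}"
      using elim finite_subset[of "actions c" "Pow {1..num_arms c}"] by (auto simp: valid_ctx_def)
    obtain A where A: "A \<in> actions c" "(MIN A\<in>actions c. g_fun \<Gamma> A (latency c) (mean_reward \<psi> c)) = g_fun \<Gamma> A (latency c) (mean_reward \<psi> c)"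
      using Min_in[of "(\<lambda>A. g_fun \<Gamma> A (latency c) (mean_reward \<psi> c)) ` actions c"] fin by fastforce
    have sub: "A \<subseteq> {1..num_arms c}" using A elim by (auto simp: valid_ctx_def)
    have "\<bar>\<Sum>i\<in>A. mean_reward \<psi> c i\<bar> \<le> (\<Sum>i\<in>A. 1)"
      using \<psi>_range by (intro order.trans[OF sum_abs] sum_mono) (auto simp: mean_reward_def abs_le_iff minus_le_iff)
    also have "\<dots> \<le> n_max" using card_mono[OF _ sub] elim by simp
    finally have 1: "\<bar>\<Sum>i\<in>A. mean_reward \<psi> c i\<bar> \<le> n_max" .
    have "\<bar>latency c A * \<Gamma>\<bar> \<le> l_max * \<bar>\<Gamma>\<bar>"
      using elim A bounds_pos by (auto simp: abs_mult intro!: mult_right_mono)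
    then have "\<bar>g_fun \<Gamma> A (latency c) (mean_reward \<psi> c)\<bar> \<le> l_max * \<bar>\<Gamma>\<bar> + n_max"
      using 1 unfolding g_fun_def by linarith
    then show ?case unfolding A(2) by simp
  qed
qed

lemma measurable_round_latency[measurable]: "round_latency \<in> borel_measurable round_space"
  unfolding round_latency_def round_space_def split_beta' by measurable

lemma measurable_round_reward[measurable]: "round_reward \<psi> \<in> borel_measurable round_space"
proof -
  have "(\<lambda>r. \<Sum>i\<in>fst (snd r). mean_reward \<psi> (fst r) i) \<in> borel_measurable round_space"
    by (rule measurable_compose_countable'[where I="Fpow UNIV" and g="\<lambda>r. fst (snd r)"])
       (auto simp: countable_Fpow action_space_def round_space_def)
  then show ?thesis unfolding round_reward_def split_beta' .
qed

lemma measurable_cumulative_reward[measurable]: "(\<lambda>\<omega>. cumulative_reward \<psi> \<omega> t) \<in> borel_measurable (\<Pi>\<^sub>M j\<in>UNIV. round_space)"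
proof -
  have [measurable]: "(\<lambda>\<omega>. rounds_completed \<omega> t) \<in> (\<Pi>\<^sub>M j\<in>UNIV. round_space) \<rightarrow>\<^sub>M count_space UNIV"
    unfolding rounds_completed_def Greatest_def
    by (rule measurable_THE[where I=UNIV]) (auto intro: order.antisym)
  show ?thesis unfolding cumulative_reward_def by measurable
qed

end

end

theory Submission
  imports Defs
begin

text \<open>
  Write \<open>S\<^sub>j\<close> for the time at which round \<open>j\<close> starts and \<open>m\<^sub>j\<close> for the minimum of \<open>g\<close> over the
  actions available in round \<open>j\<close>. Rounds with \<open>S\<^sub>j \<le> t\<close> are the completed ones plus the one in
  progress, so the sum of \<open>\<Gamma> l\<^sub>j - r\<^sub>j\<close> over them differs from \<open>\<Gamma> t - q(t)\<close> by a bounded amount.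
  Each summand is at least \<open>m\<^sub>j\<close>, with equality for the policy that minimizes \<open>g\<close> greedily. As \<open>S\<^sub>j\<close>
  depends only on the past and the context of round \<open>j\<close> is independent of it, the stopped sum of the
  \<open>m\<^sub>j\<close> has expectation \<open>0\<close> when \<open>\<Gamma>\<close> is a root of \<open>E[min g]\<close>. Hence \<open>E[q(t)] \<le> \<Gamma> t + O(1)\<close>
  for every policy, and \<open>E[q(t)] \<ge> \<Gamma> t - O(1)\<close> for the greedy one. A root exists and is unique
  because \<open>E[min g]\<close> is Lipschitz in \<open>\<Gamma>\<close> with slope at least \<open>l_min\<close>.
\<close>

section \<open>Pathwise accounting for a stopped sum\<close>

text \<open>The indicator tests the start of round \<open>j\<close>, so earlier rounds decide it;
  testing the end would involve \<open>l j\<close> itself. The price is one extra round, the one in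
  progress at time \<open>t\<close>: it ends at most \<open>l_max\<close> after \<open>t\<close>,
  and its reward is at most \<open>b\<close> in absolute value. The cap \<open>N\<close> is
  deterministic and lies beyond every round that can start by time \<open>t\<close>, so the sum has
  a fixed finite range.\<close>

lemma stopped_sum_bound:
  fixes l r :: "nat \<Rightarrow> real"
  assumes lmin: "0 < l_min" and l: "\<And>j. l j \<in> {l_min..l_max}" and r: "\<And>j. \<bar>r j\<bar> \<le> b"
    and t: "0 \<le> t" "t < real N * l_min"
  shows "\<bar>(\<Sum>j<N. if (\<Sum>i<j. l i) \<le> t then \<Gamma> * l j - r j else 0)
            - (\<Gamma> * t - (\<Sum>j<(GREATEST k. (\<Sum>i<k. l i) \<le> t). r j))\<bar> \<le> \<bar>\<Gamma>\<bar> * l_max + b"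
proof -
  define S where "S k = (\<Sum>i<k. l i)" for k
  have lpos: "0 \<le> l j" for j using l[of j] lmin by auto
  have S_ge: "real k * l_min \<le> S k" for k
    using sum_mono[of "{..<k}" "\<lambda>_. l_min" l] l by (auto simp: S_def)
  have S_mono: "S i \<le> S j" if "i \<le> j" for i j
    unfolding S_def using that lpos by (intro sum_mono2) auto
  have lt_N: "k < N" if "S k \<le> t" for k
  proof -
    have "real k * l_min < real N * l_min" using S_ge[of k] that t by linarith
    then show ?thesis using lmin by simp
  qed
  define K where "K = (GREATEST k. S k \<le> t)"
  have S0: "S 0 \<le> t" using t by (simp add: S_def)
  have K: "S K \<le> t"
    unfolding K_def by (rule GreatestI_nat[of "\<lambda>k. S k \<le> t" 0 N]) (use S0 lt_N in \<open>auto intro: less_imp_le\<close>)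
  have K_max: "k \<le> K" if "S k \<le> t" for k
    unfolding K_def by (rule Greatest_le_nat[of "\<lambda>k. S k \<le> t" k N]) (use that lt_N in \<open>auto intro: less_imp_le\<close>)
  have iff: "S j \<le> t \<longleftrightarrow> j \<le> K" for j
    using K_max S_mono[of j K] K by force
  \<comment> \<open>With rounds numbered from 0, those below \<open>K\<close> are completed and
    round \<open>K\<close> is in progress, hence the \<open>Suc\<close>. As \<open>K < N\<close>,
    the cap cuts nothing off.\<close>
  have "{..<N} \<inter> {j. j \<le> K} = {..<Suc K}" using lt_N[OF K] by auto
  then have "(\<Sum>j<N. if S j \<le> t then \<Gamma> * l j - r j else 0) = (\<Sum>j<Suc K. \<Gamma> * l j - r j)"
    by (simp add: iff sum.If_cases)
  also have "\<dots> = \<Gamma> * S (Suc K) - (\<Sum>j<K. r j) - r K"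
    by (simp add: S_def sum_subtractf sum_distrib_left distrib_left)
  finally have eq: "(\<Sum>j<N. if S j \<le> t then \<Gamma> * l j - r j else 0) - (\<Gamma> * t - (\<Sum>j<K. r j))
      = \<Gamma> * (S (Suc K) - t) - r K" by (simp add: algebra_simps)
  have "t < S (Suc K)" using iff[of "Suc K"] by auto
  moreover have "S (Suc K) \<le> t + l_max" using K l[of K] by (simp add: S_def)
  ultimately have "\<bar>S (Suc K) - t\<bar> \<le> l_max" by linarith
  then have "\<bar>\<Gamma> * (S (Suc K) - t)\<bar> \<le> \<bar>\<Gamma>\<bar> * l_max"
    by (simp add: abs_mult mult_left_mono)
  then show ?thesis using eq r[of K] unfolding S_def K_def by linarith
qed

section \<open>Marginals of the Ionescu-Tulcea measure\<close>

context Ionescu_Tulcea begin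

text \<open>For an initial segment the projection in the definition of \<open>CI\<close> keeps every
  coordinate generated so far. This opens the finite marginals of the limit to the recursion behind
  \<open>C\<close>.\<close>

lemma CI_atLeastLessThan: "CI {0..<n} = C 0 n (\<lambda>_. undefined)"
proof -
  have u: "up_to {0..<n} = n"
  proof (rule antisym)
    show "up_to {0..<n} \<le> n" by (subst up_to_iff) auto
    show "n \<le> up_to {0..<n}" using up_to[of "{0..<n}"] by auto
  qed
  show ?thesis
    unfolding CI_def u using distr_C[of n n "\<lambda>_. undefined" 0] by simp
qed

text \<open>This disintegration identifies \<open>P n\<close> as the conditional law of coordinate
  \<open>n\<close> given the earlier ones. It rests on the recursion that obtains the marginal on
  \<open>{0..<Suc n}\<close> from the one on \<open>{0..<n}\<close> by binding
  \<open>eP n\<close>.\<close>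

lemma nn_integral_lim:
  assumes f: "f \<in> borel_measurable (PiM {0..<n} M \<Otimes>\<^sub>M M n)"
  shows "(\<integral>\<^sup>+\<omega>. f (restrict \<omega> {0..<n}, \<omega> n) \<partial>PF.lim) =
    (\<integral>\<^sup>+\<omega>. (\<integral>\<^sup>+x. f (restrict \<omega> {0..<n}, x) \<partial>P n (restrict \<omega> {0..<n})) \<partial>PF.lim)"
proof -
  let ?u = "\<lambda>_::nat. undefined :: 'a"
  let ?f = "\<lambda>\<omega>. f (restrict \<omega> {0..<n}, \<omega> n)"
  have f'[measurable]: "?f \<in> borel_measurable (PiM {0..<Suc n} M)"
    by (rule measurable_compose[OF _ f])
       (auto intro!: measurable_Pair measurable_restrict_subset measurable_component_singleton)
  have lim_meas: "(\<lambda>\<omega>. restrict \<omega> J) \<in> PF.lim \<rightarrow>\<^sub>M PiM J M" for J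
    by (subst measurable_cong_sets[OF PF.sets_lim refl]) (simp add: measurable_restrict_subset)
  have inner: "(\<lambda>\<omega>. \<integral>\<^sup>+x. f (\<omega>, x) \<partial>P n \<omega>) \<in> borel_measurable (PiM {0..<n} M)"
    using f by (intro nn_integral_measurable_subprob_algebra2[where N="M n"]) (auto simp: P)
  \<comment> \<open>The integrand reads coordinates up to \<open>n\<close> only, so a trajectory may
    be replaced by its restriction to \<open>{0..<Suc n}\<close>, whose law is known.\<close>
  have "(\<integral>\<^sup>+\<omega>. ?f \<omega> \<partial>PF.lim) = (\<integral>\<^sup>+\<omega>. ?f (restrict \<omega> {0..<Suc n}) \<partial>PF.lim)"
    by (simp add: Int_absorb1)
  also have "\<dots> = (\<integral>\<^sup>+\<omega>. ?f \<omega> \<partial>distr PF.lim (PiM {0..<Suc n} M) (\<lambda>\<omega>. restrict \<omega> {0..<Suc n}))"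
    by (rule nn_integral_distr[symmetric, OF lim_meas]) simp
  also have "\<dots> = (\<integral>\<^sup>+\<omega>. ?f \<omega> \<partial>(C 0 n ?u \<bind> eP n))"
    by (simp add: distr_lim CI_atLeastLessThan)
  also have "\<dots> = (\<integral>\<^sup>+\<omega>. \<integral>\<^sup>+\<omega>'. ?f \<omega>' \<partial>eP n \<omega> \<partial>C 0 n ?u)"
  proof (rule nn_integral_bind[OF f'])
    have "sets (C 0 n ?u) = sets (PiM {0..<n} M)" using sets_C[of ?u 0 n] by simp
    from measurable_cong_sets[OF this refl]
    show "eP n \<in> C 0 n ?u \<rightarrow>\<^sub>M subprob_algebra (PiM {0..<Suc n} M)"
      using measurable_eP[of n] by blast
  qed
  also have "\<dots> = (\<integral>\<^sup>+\<omega>. \<integral>\<^sup>+x. f (\<omega>, x) \<partial>P n \<omega> \<partial>C 0 n ?u)"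
  proof (rule nn_integral_cong)
    fix \<omega> assume "\<omega> \<in> space (C 0 n ?u)"
    then have \<omega>: "\<omega> \<in> space (PiM {0..<n} M)" by (simp add: space_C)
    \<comment> \<open>\<open>eP n\<close> writes coordinate \<open>n\<close> only. Points of the
      finite product are \<open>undefined\<close> from \<open>n\<close> onwards, so cutting off at
      \<open>n\<close> recovers exactly the old point.\<close>
    then have "restrict (fun_upd \<omega> n x) {0..<n} = \<omega>" for x
      by (auto simp: space_PiM PiE_iff extensional_def restrict_def fun_eq_iff)
    then show "(\<integral>\<^sup>+\<omega>'. ?f \<omega>' \<partial>eP n \<omega>) = (\<integral>\<^sup>+x. f (\<omega>, x) \<partial>P n \<omega>)"
      using \<omega> by (simp add: nn_integral_eP)
  qed
  also have "\<dots> = (\<integral>\<^sup>+\<omega>. \<integral>\<^sup>+x. f (\<omega>, x) \<partial>P n \<omega> \<partial>distr PF.lim (PiM {0..<n} M) (\<lambda>\<omega>. restrict \<omega> {0..<n}))"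
    by (simp add: distr_lim CI_atLeastLessThan)
  also have "\<dots> = (\<integral>\<^sup>+\<omega>. (\<integral>\<^sup>+x. f (restrict \<omega> {0..<n}, x) \<partial>P n (restrict \<omega> {0..<n})) \<partial>PF.lim)"
    by (rule nn_integral_distr[OF lim_meas]) (simp add: inner)
  finally show ?thesis .
qed

text \<open>The whole space is the cylinder over the empty index set, so its mass is that of the
  one-point marginal \<open>CI {}\<close>.\<close>

lemma prob_space_lim: "prob_space PF.lim"
proof (rule prob_spaceI)
  have "emeasure PF.lim (space PF.lim) = emeasure PF.lim (PF.emb UNIV {} {\<lambda>_. undefined})"
    by (auto simp: prod_emb_def space_PiM restrict_def intro!: arg_cong[where f="emeasure _"])
  also have "\<dots> = emeasure (CI {}) {\<lambda>_. undefined}"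
    by (rule lim) (auto simp: PiM_empty)
  also have "\<dots> = 1"
    using prob_space.emeasure_space_1[OF PF.prob_space_P[of "{}"]] by (simp add: PF.space_P space_PiM)
  finally show "emeasure PF.lim (space PF.lim) = 1" .
qed

text \<open>The indicator of the exceptional set has integral zero under every kernel, hence also
  under the limit by \<open>nn_integral_lim\<close>.\<close>

lemma AE_lim:
  assumes Q[measurable]: "Measurable.pred (M n) Q"
    and AE: "\<And>\<omega>. \<omega> \<in> space (PiM {0..<n} M) \<Longrightarrow> AE x in P n \<omega>. Q x"
  shows "AE \<omega> in PF.lim. Q (\<omega> n)"
proof -
  have comp: "(\<lambda>\<omega>. \<omega> n) \<in> PF.lim \<rightarrow>\<^sub>M M n"
    by (subst measurable_cong_sets[OF PF.sets_lim refl]) simp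
  let ?f = "\<lambda>p. indicator {x \<in> space (M n). \<not> Q x} (snd p) :: ennreal"
  have sp: "restrict \<omega> {0..<n} \<in> space (PiM {0..<n} M)" if "\<omega> \<in> space (PiM UNIV M)" for \<omega>
    using that by (auto simp: space_PiM)
  have m: "{x \<in> space (M n). \<not> Q x} \<in> sets (M n)" by measurable
  have "(\<integral>\<^sup>+\<omega>. ?f (restrict \<omega> {0..<n}, \<omega> n) \<partial>PF.lim)
     = (\<integral>\<^sup>+\<omega>. (\<integral>\<^sup>+x. ?f (restrict \<omega> {0..<n}, x) \<partial>P n (restrict \<omega> {0..<n})) \<partial>PF.lim)"
    by (intro nn_integral_lim) measurable
  also have "\<dots> = (\<integral>\<^sup>+(\<omega> :: nat \<Rightarrow> 'a). 0 \<partial>PF.lim)"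
  proof (rule nn_integral_cong)
    fix \<omega> assume "\<omega> \<in> space PF.lim"
    then have \<omega>: "restrict \<omega> {0..<n} \<in> space (PiM {0..<n} M)" using sp by simp
    show "(\<integral>\<^sup>+x. ?f (restrict \<omega> {0..<n}, x) \<partial>P n (restrict \<omega> {0..<n})) = 0"
      using AE[OF \<omega>] m sets_P[OF \<omega>]
      by (subst nn_integral_0_iff_AE) (auto simp: measurable_cong_sets[OF sets_P[OF \<omega>] refl] elim: eventually_mono)
  qed
  also have "\<dots> = 0" by simp
  finally have "AE \<omega> in PF.lim. ?f (restrict \<omega> {0..<n}, \<omega> n) = 0"
    using m comp by (subst (asm) nn_integral_0_iff_AE) auto
  then show ?thesis
    using AE_space by eventually_elim (use measurable_space[OF comp] in \<open>auto simp: indicator_def split: if_splits\<close>)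
qed

end

section \<open>The root of the expected minimum\<close>

definition min_g :: "(real^'d \<Rightarrow> real) \<Rightarrow> real \<Rightarrow> 'd::finite ctx \<Rightarrow> real" where
  "min_g \<psi> \<Gamma> c = (MIN A\<in>actions c. g_fun \<Gamma> A (latency c) (mean_reward \<psi> c))"

lemma actions_ctx_space:
  fixes c :: "'d::finite ctx"
  assumes "c \<in> space ctx_space"
  shows "finite (actions c)" "actions c \<noteq> {}" "actions c \<subseteq> Fpow UNIV"
    and "\<And>A. A \<in> actions c \<Longrightarrow> A \<subseteq> {1..num_arms c}"
proof -
  have c: "actions c \<noteq> {}" "actions c \<subseteq> Pow {1..num_arms c}"
    using space_ctx_spaceD[OF assms] by (auto simp: valid_ctx_def)
  then show "actions c \<noteq> {}" "\<And>A. A \<in> actions c \<Longrightarrow> A \<subseteq> {1..num_arms c}" by auto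
  show "finite (actions c)" using c finite_subset by blast
  show "actions c \<subseteq> Fpow UNIV" using c finite_subset[of _ "{1..num_arms c}"] by (auto simp: Fpow_def)
qed

lemma min_g_le:
  fixes c :: "'d::finite ctx"
  assumes "c \<in> space ctx_space" "A \<in> actions c"
  shows "min_g \<psi> \<Gamma> c \<le> g_fun \<Gamma> A (latency c) (mean_reward \<psi> c)"
  unfolding min_g_def using assms actions_ctx_space[OF assms(1)] by (intro Min_le) auto

lemma min_g_attained:
  fixes c :: "'d::finite ctx"
  assumes "c \<in> space ctx_space"
  obtains A where "A \<in> actions c" "g_fun \<Gamma> A (latency c) (mean_reward \<psi> c) = min_g \<psi> \<Gamma> c"
proof -
  have "min_g \<psi> \<Gamma> c \<in> (\<lambda>A. g_fun \<Gamma> A (latency c) (mean_reward \<psi> c)) ` actions c"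
    unfolding min_g_def using actions_ctx_space[OF assms] by (intro Min_in) auto
  then show thesis using that by force
qed

text \<open>There are only countably many finite sets of arms, so it suffices to treat a fixed
  action.\<close>

lemma measurable_mem_actions[measurable]:
  assumes [measurable]: "f \<in> M \<rightarrow>\<^sub>M ctx_space" "h \<in> M \<rightarrow>\<^sub>M action_space"
  shows "Measurable.pred M (\<lambda>x. h x \<in> actions (f x))"
proof (rule measurable_compose_countable'[where I="Fpow UNIV" and g=h])
  show "Measurable.pred M (\<lambda>x. A \<in> actions (f x))" for A
    by (rule measurable_compose[OF measurable_compose[OF assms(1) measurable_actions]]) simp
qed (use assms in \<open>auto simp: countable_Fpow action_space_def\<close>)

lemma measurable_round_proj[measurable]:
  "fst \<in> round_space \<rightarrow>\<^sub>M ctx_space" "(\<lambda>r. fst (snd r)) \<in> round_space \<rightarrow>\<^sub>M action_space"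
  unfolding round_space_def by measurable

context latency_bandit begin

lemma space_P: "space P = space ctx_space"
  by (rule sets_eq_imp_space_eq[OF sets_P])

lemma measurable_min_g_ctx[measurable]: "min_g \<psi> \<Gamma> \<in> borel_measurable ctx_space"
proof -
  have "min_g \<psi> \<Gamma> \<in> borel_measurable P"
    using measurable_min_g[of \<Gamma>] unfolding min_g_def[abs_def] .
  then show ?thesis by (simp only: measurable_cong_sets[OF sets_P refl])
qed

lemma integrable_min_g_ctx: "integrable P (min_g \<psi> \<Gamma>)"
  using integrable_min_g[of \<Gamma>] unfolding min_g_def[abs_def] .

lemma mean_reward_sum_bound:
  assumes "c \<in> space ctx_space" "num_arms c \<le> n_max" "A \<in> actions c"
  shows "\<bar>\<Sum>i\<in>A. mean_reward \<psi> c i\<bar> \<le> n_max"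
proof -
  have "\<bar>\<Sum>i\<in>A. mean_reward \<psi> c i\<bar> \<le> (\<Sum>i\<in>A. 1)"
  proof (rule order.trans[OF sum_abs], rule sum_mono)
    show "\<bar>mean_reward \<psi> c i\<bar> \<le> 1" for i
      using \<psi>_range[of "feature c i"] by (simp add: mean_reward_def abs_le_iff)
  qed
  also have "\<dots> \<le> n_max"
    using card_mono[OF _ actions_ctx_space(4)[OF assms(1,3)]] assms(2) by simp
  finally show ?thesis .
qed

text \<open>Passing from \<Gamma> to \<Gamma>' shifts \<open>g\<close> by the latency times
  \<open>\<Gamma>' - \<Gamma>\<close>, action by action. Comparing the two minima at the minimizer
  for \<Gamma>' gives the lower bound, and at the minimizer for \<Gamma> the upper one.\<close>

lemma min_g_increment:
  assumes c: "c \<in> space ctx_space" and l: "\<And>A. A \<in> actions c \<Longrightarrow> latency c A \<in> {l_min..l_max}"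
    and le: "\<Gamma> \<le> \<Gamma>'"
  shows "l_min * (\<Gamma>' - \<Gamma>) \<le> min_g \<psi> \<Gamma>' c - min_g \<psi> \<Gamma> c"
    and "min_g \<psi> \<Gamma>' c - min_g \<psi> \<Gamma> c \<le> l_max * (\<Gamma>' - \<Gamma>)"
proof -
  have g: "g_fun \<Gamma>' A (latency c) \<mu> = g_fun \<Gamma> A (latency c) \<mu> + latency c A * (\<Gamma>' - \<Gamma>)" for A \<mu>
    by (simp add: g_fun_def algebra_simps)
  obtain A where A: "A \<in> actions c" "g_fun \<Gamma>' A (latency c) (mean_reward \<psi> c) = min_g \<psi> \<Gamma>' c"
    using min_g_attained[OF c] by blast
  have "l_min * (\<Gamma>' - \<Gamma>) \<le> latency c A * (\<Gamma>' - \<Gamma>)"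
    using l[OF A(1)] le by (intro mult_right_mono) auto
  then show "l_min * (\<Gamma>' - \<Gamma>) \<le> min_g \<psi> \<Gamma>' c - min_g \<psi> \<Gamma> c"
    using min_g_le[OF c A(1), of \<psi> \<Gamma>] g[of A "mean_reward \<psi> c"] A(2) by linarith
  obtain B where B: "B \<in> actions c" "g_fun \<Gamma> B (latency c) (mean_reward \<psi> c) = min_g \<psi> \<Gamma> c"
    using min_g_attained[OF c] by blast
  have "latency c B * (\<Gamma>' - \<Gamma>) \<le> l_max * (\<Gamma>' - \<Gamma>)"
    using l[OF B(1)] le by (intro mult_right_mono) auto
  then show "min_g \<psi> \<Gamma>' c - min_g \<psi> \<Gamma> c \<le> l_max * (\<Gamma>' - \<Gamma>)"
    using min_g_le[OF c B(1), of \<psi> \<Gamma>'] g[of B "mean_reward \<psi> c"] B(2) by linarith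
qed

lemma expectation_min_g_increment:
  assumes "\<Gamma> \<le> \<Gamma>'"
  shows "l_min * (\<Gamma>' - \<Gamma>) \<le> expectation (min_g \<psi> \<Gamma>') - expectation (min_g \<psi> \<Gamma>)"
    and "expectation (min_g \<psi> \<Gamma>') - expectation (min_g \<psi> \<Gamma>) \<le> l_max * (\<Gamma>' - \<Gamma>)"
proof -
  have diff: "expectation (min_g \<psi> \<Gamma>') - expectation (min_g \<psi> \<Gamma>) = expectation (\<lambda>c. min_g \<psi> \<Gamma>' c - min_g \<psi> \<Gamma> c)"
    by (simp add: integrable_min_g_ctx)
  have "AE c in P. l_min * (\<Gamma>' - \<Gamma>) \<le> min_g \<psi> \<Gamma>' c - min_g \<psi> \<Gamma> c \<and>
      min_g \<psi> \<Gamma>' c - min_g \<psi> \<Gamma> c \<le> l_max * (\<Gamma>' - \<Gamma>)"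
    using bounded AE_space
    by eventually_elim (use min_g_increment assms space_P in blast)
  then have *: "AE c in P. l_min * (\<Gamma>' - \<Gamma>) \<le> min_g \<psi> \<Gamma>' c - min_g \<psi> \<Gamma> c"
      "AE c in P. min_g \<psi> \<Gamma>' c - min_g \<psi> \<Gamma> c \<le> l_max * (\<Gamma>' - \<Gamma>)"
    by (auto elim: eventually_mono)
  show "l_min * (\<Gamma>' - \<Gamma>) \<le> expectation (min_g \<psi> \<Gamma>') - expectation (min_g \<psi> \<Gamma>)"
    unfolding diff by (rule integral_ge_const) (use * in \<open>simp_all add: integrable_min_g_ctx\<close>)
  show "expectation (min_g \<psi> \<Gamma>') - expectation (min_g \<psi> \<Gamma>) \<le> l_max * (\<Gamma>' - \<Gamma>)"
    unfolding diff by (rule integral_le_const) (use * in \<open>simp_all add: integrable_min_g_ctx\<close>)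
qed

lemma ex1_root: "\<exists>!\<Gamma>. expectation (min_g \<psi> \<Gamma>) = 0"
proof -
  define G where "G \<Gamma> = expectation (min_g \<psi> \<Gamma>)" for \<Gamma>
  note inc = expectation_min_g_increment[folded G_def]
  have "\<bar>G x - G y\<bar> \<le> l_max * \<bar>x - y\<bar>" for x y
  proof (cases "x \<le> y")
    case True
    have "0 \<le> l_min * (y - x)" using True bounds_pos by simp
    then show ?thesis using inc[OF True] True by simp
  next
    case False
    have "0 \<le> l_min * (x - y)" using False bounds_pos by simp
    then show ?thesis using inc[of y x] False by simp
  qed
  then have "l_max-lipschitz_on UNIV G"
    using bounds_pos by (intro lipschitz_onI) (auto simp: dist_real_def)
  then have cont: "continuous_on UNIV G" by (rule lipschitz_on_continuous_on)
  \<comment> \<open>As \<open>G\<close> grows at rate at least \<open>l_min\<close>, moving by this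
    distance from 0 changes it by at least \<open>\<bar>G 0\<bar>\<close>; hence
    \<open>G (-x) \<le> 0 \<le> G x\<close>.\<close>
  define x where "x = \<bar>G 0\<bar> / l_min"
  have x: "0 \<le> x" "l_min * x = \<bar>G 0\<bar>" using bounds_pos by (auto simp: x_def)
  have "G (-x) \<le> 0" "0 \<le> G x" using inc(1)[of "-x" 0] inc(1)[of 0 x] x by auto
  then obtain \<Gamma> where \<Gamma>: "G \<Gamma> = 0"
    using IVT'[of G "-x" 0 x] x continuous_on_subset[OF cont] by auto
  have mono: "G a < G b" if "a < b" for a b
  proof -
    have "0 < l_min * (b - a)" using that bounds_pos by simp
    then show ?thesis using inc(1)[of a b] that by linarith
  qed
  show ?thesis
    unfolding G_def[symmetric] using \<Gamma> mono by (metis linorder_neq_iff)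
qed

section \<open>The law of the rounds\<close>

text \<open>The noise kernel has mass one, so it drops out of an integrand that sees only the
  context and the action. The three nested binds are opened one at a time, from the outside
  inwards.\<close>

lemma nn_integral_round_kernel:
  assumes pi: "\<pi> \<in> policies" and \<omega>: "\<omega> \<in> space (\<Pi>\<^sub>M j\<in>{0..<k}. round_space)"
    and f[measurable]: "f \<in> borel_measurable (ctx_space \<Otimes>\<^sub>M action_space)"
  shows "(\<integral>\<^sup>+r. f (fst r, fst (snd r)) \<partial>round_kernel P \<psi> \<eta> \<pi> k \<omega>) =
    (\<integral>\<^sup>+c. \<integral>\<^sup>+A. f (c, A) \<partial>\<pi> k (history \<psi> k \<omega>) c \<partial>P)"
proof -
  let ?h = "history \<psi> k \<omega>"
  let ?F = "\<lambda>r. f (fst r, fst (snd r))"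
  have h: "?h \<in> space (history_space k)"
    using measurable_space[OF measurable_history \<omega>] by simp
  have pk: "(\<lambda>(h, c). \<pi> k h c) \<in> history_space k \<Otimes>\<^sub>M ctx_space \<rightarrow>\<^sub>M prob_algebra action_space"
    using pi by (auto simp: policies_def)
  have ek: "(\<lambda>(\<omega>, c, A). \<eta> k \<omega> c A) \<in>
       (\<Pi>\<^sub>M j\<in>{0..<k}. round_space) \<Otimes>\<^sub>M ctx_space \<Otimes>\<^sub>M action_space \<rightarrow>\<^sub>M prob_algebra noise_space"
    using noise by (auto simp: zero_mean_noise_def)
  \<comment> \<open>Fixing the past turns the jointly measurable policy and noise into kernels on
    contexts and on pairs of context and action.\<close>
  have p[measurable]: "(\<lambda>c. \<pi> k ?h c) \<in> ctx_space \<rightarrow>\<^sub>M prob_algebra action_space"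
    using measurable_compose[OF measurable_Pair1'[OF h] pk] by simp
  have e[measurable]: "(\<lambda>p. \<eta> k \<omega> (fst p) (snd p)) \<in> ctx_space \<Otimes>\<^sub>M action_space \<rightarrow>\<^sub>M prob_algebra noise_space"
    using measurable_compose[OF measurable_Pair1'[OF \<omega>] ek] by (simp add: split_beta')
  have F[measurable]: "?F \<in> borel_measurable round_space" by measurable
  have r: "(\<lambda>x. return round_space (fst (fst x), snd (fst x), snd x)) \<in>
      (ctx_space \<Otimes>\<^sub>M action_space) \<Otimes>\<^sub>M noise_space \<rightarrow>\<^sub>M prob_algebra round_space"
    by (rule measurable_compose[OF _ measurable_return_prob_space]) (simp add: round_space_def)
  have b1[measurable]: "(\<lambda>p. \<eta> k \<omega> (fst p) (snd p) \<bind> (\<lambda>e. return round_space (fst p, snd p, e)))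
      \<in> ctx_space \<Otimes>\<^sub>M action_space \<rightarrow>\<^sub>M prob_algebra round_space"
    by (rule measurable_bind_prob_space2[where N=noise_space]) (use r in \<open>simp_all add: split_beta'\<close>)
  have b2: "(\<lambda>c. \<pi> k ?h c \<bind> (\<lambda>A. \<eta> k \<omega> c A \<bind> (\<lambda>e. return round_space (c, A, e))))
      \<in> ctx_space \<rightarrow>\<^sub>M prob_algebra round_space"
    by (rule measurable_bind_prob_space2[where N=action_space]) (use b1 in \<open>simp_all add: split_beta'\<close>)
  have "(\<integral>\<^sup>+r. ?F r \<partial>round_kernel P \<psi> \<eta> \<pi> k \<omega>) =
    (\<integral>\<^sup>+c. \<integral>\<^sup>+r. ?F r \<partial>(\<pi> k ?h c \<bind> (\<lambda>A. \<eta> k \<omega> c A \<bind> (\<lambda>e. return round_space (c, A, e)))) \<partial>P)"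
    unfolding round_kernel_def
    by (rule nn_integral_bind[OF F])
       (use measurable_prob_algebraD[OF b2] in \<open>simp add: measurable_cong_sets[OF sets_P refl]\<close>)
  also have "\<dots> = (\<integral>\<^sup>+c. \<integral>\<^sup>+A. f (c, A) \<partial>\<pi> k ?h c \<partial>P)"
  proof (rule nn_integral_cong)
    fix c assume "c \<in> space P"
    then have c: "c \<in> space ctx_space" by (simp add: space_P)
    have sets_pi: "sets (\<pi> k ?h c) = sets action_space"
      using measurable_space[OF p c] by (simp add: space_prob_algebra)
    have m: "(\<lambda>A. \<eta> k \<omega> c A \<bind> (\<lambda>e. return round_space (c, A, e))) \<in> action_space \<rightarrow>\<^sub>M prob_algebra round_space"
      using measurable_compose[OF measurable_Pair1'[OF c] b1] by simp
    have "(\<integral>\<^sup>+r. ?F r \<partial>(\<pi> k ?h c \<bind> (\<lambda>A. \<eta> k \<omega> c A \<bind> (\<lambda>e. return round_space (c, A, e))))) =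
        (\<integral>\<^sup>+A. \<integral>\<^sup>+r. ?F r \<partial>(\<eta> k \<omega> c A \<bind> (\<lambda>e. return round_space (c, A, e))) \<partial>\<pi> k ?h c)"
      by (rule nn_integral_bind[OF F])
         (use measurable_prob_algebraD[OF m] in \<open>simp add: measurable_cong_sets[OF sets_pi refl]\<close>)
    also have "\<dots> = (\<integral>\<^sup>+A. f (c, A) \<partial>\<pi> k ?h c)"
    proof (rule nn_integral_cong)
      fix A assume "A \<in> space (\<pi> k ?h c)"
      then have A: "A \<in> space action_space" using sets_eq_imp_space_eq[OF sets_pi] by simp
      have cA: "(c, A) \<in> space (ctx_space \<Otimes>\<^sub>M action_space)" using c A by (simp add: space_pair_measure)
      have eta: "sets (\<eta> k \<omega> c A) = sets noise_space" "prob_space (\<eta> k \<omega> c A)"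
        using measurable_space[OF e cA] by (auto simp: space_prob_algebra)
      have ret: "(\<lambda>e. return round_space (c, A, e)) \<in> noise_space \<rightarrow>\<^sub>M prob_algebra round_space"
        using measurable_compose[OF measurable_Pair1'[OF cA] r] by simp
      have "(\<integral>\<^sup>+r. ?F r \<partial>(\<eta> k \<omega> c A \<bind> (\<lambda>e. return round_space (c, A, e)))) =
          (\<integral>\<^sup>+e. \<integral>\<^sup>+r. ?F r \<partial>return round_space (c, A, e) \<partial>\<eta> k \<omega> c A)"
        by (rule nn_integral_bind[OF F])
           (use measurable_prob_algebraD[OF ret] in \<open>simp add: measurable_cong_sets[OF eta(1) refl]\<close>)
      also have "\<dots> = (\<integral>\<^sup>+e. f (c, A) \<partial>\<eta> k \<omega> c A)"
      proof (rule nn_integral_cong)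
        fix e assume "e \<in> space (\<eta> k \<omega> c A)"
        then have "(c, A, e) \<in> space round_space"
          using c A sets_eq_imp_space_eq[OF eta(1)] by (simp add: round_space_def space_pair_measure)
        then show "(\<integral>\<^sup>+r. ?F r \<partial>return round_space (c, A, e)) = f (c, A)"
          by (simp add: nn_integral_return)
      qed
      also have "\<dots> = f (c, A)"
        using prob_space.emeasure_space_1[OF eta(2)] by simp
      finally show "(\<integral>\<^sup>+r. ?F r \<partial>(\<eta> k \<omega> c A \<bind> (\<lambda>e. return round_space (c, A, e)))) = f (c, A)" .
    qed
    finally show "(\<integral>\<^sup>+r. ?F r \<partial>(\<pi> k ?h c \<bind> (\<lambda>A. \<eta> k \<omega> c A \<bind> (\<lambda>e. return round_space (c, A, e))))) =
      (\<integral>\<^sup>+A. f (c, A) \<partial>\<pi> k ?h c)" .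
  qed
  finally show ?thesis .
qed

lemma policy_space:
  assumes "\<pi> \<in> policies" "h \<in> space (history_space k)" "c \<in> space ctx_space"
  shows "\<pi> k h c \<in> space (prob_algebra action_space)"
proof -
  have "(\<lambda>(h, c). \<pi> k h c) \<in> history_space k \<Otimes>\<^sub>M ctx_space \<rightarrow>\<^sub>M prob_algebra action_space"
    using assms by (auto simp: policies_def)
  from measurable_space[OF this, of "(h, c)"] show ?thesis
    using assms by (simp add: space_pair_measure)
qed

text \<open>The policy kernel has mass one as well, so nothing but the draw from \<open>P\<close>
  remains. That the result does not depend on the past is the source of the independence used
  later.\<close>

lemma nn_integral_round_kernel_ctx:
  assumes pi: "\<pi> \<in> policies" and \<omega>: "\<omega> \<in> space (\<Pi>\<^sub>M j\<in>{0..<k}. round_space)"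
    and B[measurable]: "B \<in> sets ctx_space"
  shows "(\<integral>\<^sup>+r. indicator B (fst r) \<partial>round_kernel P \<psi> \<eta> \<pi> k \<omega>) = emeasure P B"
proof -
  let ?h = "history \<psi> k \<omega>"
  have h: "?h \<in> space (history_space k)"
    using measurable_space[OF measurable_history \<omega>] by simp
  have "(\<integral>\<^sup>+r. indicator B (fst r) \<partial>round_kernel P \<psi> \<eta> \<pi> k \<omega>) =
      (\<integral>\<^sup>+c. \<integral>\<^sup>+A. indicator B c \<partial>\<pi> k ?h c \<partial>P)"
    using nn_integral_round_kernel[OF pi \<omega>, of "\<lambda>p. indicator B (fst p)"] by simp
  also have "\<dots> = (\<integral>\<^sup>+c. indicator B c \<partial>P)"
  proof (rule nn_integral_cong)
    fix c assume "c \<in> space P"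
    then have "prob_space (\<pi> k ?h c)"
      using policy_space[OF pi h] by (simp add: space_P space_prob_algebra)
    from prob_space.emeasure_space_1[OF this]
    show "(\<integral>\<^sup>+A. indicator B c \<partial>\<pi> k ?h c) = indicator B c" by simp
  qed
  also have "\<dots> = emeasure P B" by (simp add: sets_P)
  finally show ?thesis .
qed

lemma AE_round_kernel:
  assumes pi: "\<pi> \<in> policies" and \<omega>: "\<omega> \<in> space (\<Pi>\<^sub>M j\<in>{0..<k}. round_space)"
    and Q[measurable]: "Measurable.pred (ctx_space \<Otimes>\<^sub>M action_space) (\<lambda>p. Q (fst p) (snd p))"
    and AE: "AE c in P. AE A in \<pi> k (history \<psi> k \<omega>) c. Q c A"
  shows "AE r in round_kernel P \<psi> \<eta> \<pi> k \<omega>. Q (fst r) (fst (snd r))"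
proof -
  let ?h = "history \<psi> k \<omega>"
  \<comment> \<open>The indicator of the exceptional set turns the almost sure claim into the
    vanishing of an iterated integral.\<close>
  let ?f = "\<lambda>p. indicator {p \<in> space (ctx_space \<Otimes>\<^sub>M action_space). \<not> Q (fst p) (snd p)} p :: ennreal"
  have h: "?h \<in> space (history_space k)"
    using measurable_space[OF measurable_history \<omega>] by simp
  have sets_K: "sets (round_kernel P \<psi> \<eta> \<pi> k \<omega>) = sets round_space"
    using measurable_space[OF measurable_round_kernel[OF pi] \<omega>] by (simp add: space_prob_algebra)
  have "(\<integral>\<^sup>+r. ?f (fst r, fst (snd r)) \<partial>round_kernel P \<psi> \<eta> \<pi> k \<omega>) =
      (\<integral>\<^sup>+c. \<integral>\<^sup>+A. ?f (c, A) \<partial>\<pi> k ?h c \<partial>P)"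
    by (rule nn_integral_round_kernel[OF pi \<omega>]) measurable
  also have "\<dots> = (\<integral>\<^sup>+(c :: 'd ctx). 0 \<partial>P)"
  proof (rule nn_integral_cong_AE)
    show "AE c in P. (\<integral>\<^sup>+A. ?f (c, A) \<partial>\<pi> k ?h c) = 0"
      using AE AE_space
    proof eventually_elim
      case (elim c)
      have "(\<integral>\<^sup>+A. ?f (c, A) \<partial>\<pi> k ?h c) = (\<integral>\<^sup>+(A :: nat set). 0 \<partial>\<pi> k ?h c)"
        by (rule nn_integral_cong_AE) (use elim(1) in \<open>eventually_elim, auto\<close>)
      then show ?case by simp
    qed
  qed
  also have "\<dots> = 0" by simp
  finally have "AE r in round_kernel P \<psi> \<eta> \<pi> k \<omega>. ?f (fst r, fst (snd r)) = 0"
    by (subst (asm) nn_integral_0_iff_AE) (simp_all add: measurable_cong_sets[OF sets_K refl])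
  then show ?thesis
    using AE_space
  proof eventually_elim
    case (elim r)
    then have "r \<in> space round_space" using sets_eq_imp_space_eq[OF sets_K] by simp
    then show ?case using elim(1)
      by (auto simp: round_space_def space_pair_measure indicator_def split: if_splits)
  qed
qed

lemma space_round_space: "r \<in> space round_space \<Longrightarrow> fst r \<in> space ctx_space"
  using measurable_space[OF measurable_round_proj(1)] .

section \<open>Almost sure properties of trajectories\<close>

lemma sets_trajectory:
  assumes "\<pi> \<in> policies"
  shows "sets (trajectory P \<psi> \<eta> \<pi>) = sets (\<Pi>\<^sub>M j\<in>UNIV. round_space)"
proof -
  interpret IT: Ionescu_Tulcea "round_kernel P \<psi> \<eta> \<pi>" "\<lambda>_. round_space"
    by (rule Ionescu_Tulcea_round_kernel[OF assms])
  show ?thesis unfolding trajectory_def by simp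
qed

lemma prob_space_trajectory:
  assumes "\<pi> \<in> policies"
  shows "prob_space (trajectory P \<psi> \<eta> \<pi>)"
proof -
  interpret IT: Ionescu_Tulcea "round_kernel P \<psi> \<eta> \<pi>" "\<lambda>_. round_space"
    by (rule Ionescu_Tulcea_round_kernel[OF assms])
  show ?thesis unfolding trajectory_def by (rule IT.prob_space_lim)
qed

text \<open>The property is assumed for each round under every possible history, so
  \<open>AE_lim\<close> applies to each coordinate; as there are countably many rounds, one null set
  serves them all.\<close>

lemma AE_trajectory:
  assumes pi: "\<pi> \<in> policies"
    and Q[measurable]: "Measurable.pred (ctx_space \<Otimes>\<^sub>M action_space) (\<lambda>p. Q (fst p) (snd p))"
    and AE: "\<And>k h. h \<in> space (history_space k) \<Longrightarrow> AE c in P. AE A in \<pi> k h c. Q c A"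
  shows "AE \<omega> in trajectory P \<psi> \<eta> \<pi>. \<forall>j. Q (fst (\<omega> j)) (fst (snd (\<omega> j)))"
proof -
  interpret IT: Ionescu_Tulcea "round_kernel P \<psi> \<eta> \<pi>" "\<lambda>_. round_space"
    by (rule Ionescu_Tulcea_round_kernel[OF pi])
  have "AE \<omega> in IT.PF.lim. Q (fst (\<omega> j)) (fst (snd (\<omega> j)))" for j
  proof (rule IT.AE_lim)
    have "(\<lambda>r. (fst r, fst (snd r))) \<in> round_space \<rightarrow>\<^sub>M (ctx_space :: 'd ctx measure) \<Otimes>\<^sub>M action_space"
      by measurable
    from measurable_compose[OF this Q]
    show "Measurable.pred round_space (\<lambda>r. Q (fst r) (fst (snd r)))" by simp
    show "AE r in round_kernel P \<psi> \<eta> \<pi> j \<omega>. Q (fst r) (fst (snd r))"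
      if "\<omega> \<in> space (\<Pi>\<^sub>M j\<in>{0..<j}. round_space)" for \<omega>
      using AE_round_kernel[OF pi that Q AE] measurable_space[OF measurable_history that] by simp
  qed
  then show ?thesis unfolding trajectory_def by (simp add: AE_all_countable)
qed

text \<open>Provides the bounds that \<open>stopped_sum_bound\<close> asks for, on one almost sure
  event for all rounds, together with the availability of the chosen action, which the comparison
  with \<open>min_g\<close> needs.\<close>

lemma AE_trajectory_regular:
  assumes pi: "\<pi> \<in> policies"
  shows "AE \<omega> in trajectory P \<psi> \<eta> \<pi>. \<forall>j. fst (snd (\<omega> j)) \<in> actions (fst (\<omega> j)) \<and>
    round_latency (\<omega> j) \<in> {l_min..l_max} \<and> \<bar>round_reward \<psi> (\<omega> j)\<bar> \<le> n_max"
proof -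
  have "AE \<omega> in trajectory P \<psi> \<eta> \<pi>. \<forall>j. fst (snd (\<omega> j)) \<in> actions (fst (\<omega> j)) \<and> num_arms (fst (\<omega> j)) \<le> n_max \<and>
      latency (fst (\<omega> j)) (fst (snd (\<omega> j))) \<in> {l_min..l_max}"
  proof (rule AE_trajectory[OF pi, where Q="\<lambda>c A. A \<in> actions c \<and> num_arms c \<le> n_max \<and> latency c A \<in> {l_min..l_max}"])
    show "Measurable.pred (ctx_space \<Otimes>\<^sub>M action_space) (\<lambda>p :: 'd ctx \<times> nat set. snd p \<in> actions (fst p) \<and> num_arms (fst p) \<le> n_max \<and>
        latency (fst p) (snd p) \<in> {l_min..l_max})"
      by measurable
    fix k and h :: "nat \<Rightarrow> 'd obs" assume h: "h \<in> space (history_space k)"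
    show "AE c in P. AE A in \<pi> k h c. A \<in> actions c \<and> num_arms c \<le> n_max \<and> latency c A \<in> {l_min..l_max}"
      using bounded AE_space
    proof eventually_elim
      case (elim c)
      have "AE A in \<pi> k h c. A \<in> actions c" using pi h elim(2) by (auto simp: policies_def space_P)
      then show ?case by eventually_elim (use elim(1) in auto)
    qed
  qed
  then show ?thesis
    using AE_space
  proof eventually_elim
    case (elim \<omega>)
    have "fst (\<omega> j) \<in> space ctx_space" for j
      using elim(2) sets_eq_imp_space_eq[OF sets_trajectory[OF pi]]
      by (intro space_round_space) (auto simp: space_PiM)
    then show ?case
      using elim(1) mean_reward_sum_bound by (auto simp: round_latency_def round_reward_def split_beta')
  qed
qed

section \<open>Independence of the current context from the past\<close>

text \<open>It is enough to compare the two laws on rectangles. Conditionally on the past, the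
  context of round \<open>n\<close> has law \<open>P\<close>, so the factor
  \<open>emeasure P B\<close> is constant and leaves the integral.\<close>

lemma distr_trajectory:
  assumes pi: "\<pi> \<in> policies"
  defines "T \<equiv> trajectory P \<psi> \<eta> \<pi>"
  shows "distr T ((\<Pi>\<^sub>M j\<in>{0..<n}. round_space) \<Otimes>\<^sub>M ctx_space) (\<lambda>\<omega>. (restrict \<omega> {0..<n}, fst (\<omega> n)))
    = distr T (\<Pi>\<^sub>M j\<in>{0..<n}. round_space) (\<lambda>\<omega>. restrict \<omega> {0..<n}) \<Otimes>\<^sub>M P"
proof -
  interpret IT: Ionescu_Tulcea "round_kernel P \<psi> \<eta> \<pi>" "\<lambda>_. round_space"
    by (rule Ionescu_Tulcea_round_kernel[OF pi])
  interpret T: prob_space T unfolding T_def by (rule prob_space_trajectory[OF pi])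
  let ?R = "\<Pi>\<^sub>M j\<in>{0..<n}. (round_space :: 'd round measure)"
  have T_lim: "T = IT.PF.lim" by (simp add: T_def trajectory_def)
  note sT[measurable_cong] = sets_trajectory[OF pi, folded T_def]
  have res[measurable]: "(\<lambda>\<omega>. restrict \<omega> {0..<n}) \<in> T \<rightarrow>\<^sub>M ?R"
    by (subst measurable_cong_sets[OF sT refl]) (simp add: measurable_restrict_subset)
  have comp[measurable]: "(\<lambda>\<omega>. \<omega> n) \<in> T \<rightarrow>\<^sub>M round_space"
    by (subst measurable_cong_sets[OF sT refl]) simp
  interpret D: prob_space "distr T ?R (\<lambda>\<omega>. restrict \<omega> {0..<n})" by (rule T.prob_space_distr) simp
  show ?thesis
  proof (rule pair_measure_eqI[symmetric])
    show "sigma_finite_measure (distr T ?R (\<lambda>\<omega>. restrict \<omega> {0..<n}))" "sigma_finite_measure P" by unfold_locales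
    show "sets (distr T ?R (\<lambda>\<omega>. restrict \<omega> {0..<n}) \<Otimes>\<^sub>M P) =
        sets (distr T (?R \<Otimes>\<^sub>M ctx_space) (\<lambda>\<omega>. (restrict \<omega> {0..<n}, fst (\<omega> n))))"
      by (simp add: sets_P cong: sets_pair_measure_cong)
    fix A B assume "A \<in> sets (distr T ?R (\<lambda>\<omega>. restrict \<omega> {0..<n}))" "B \<in> sets P"
    then have A[measurable]: "A \<in> sets ?R" and B[measurable]: "B \<in> sets ctx_space" by (simp_all add: sets_P)
    let ?f = "\<lambda>p. indicator A (fst p) * indicator B (fst (snd p)) :: ennreal"
    have "emeasure (distr T (?R \<Otimes>\<^sub>M ctx_space) (\<lambda>\<omega>. (restrict \<omega> {0..<n}, fst (\<omega> n)))) (A \<times> B)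
        = (\<integral>\<^sup>+p. indicator (A \<times> B) p \<partial>distr T (?R \<Otimes>\<^sub>M ctx_space) (\<lambda>\<omega>. (restrict \<omega> {0..<n}, fst (\<omega> n))))"
      by (rule nn_integral_indicator[symmetric]) simp
    also have "\<dots> = (\<integral>\<^sup>+\<omega>. ?f (restrict \<omega> {0..<n}, \<omega> n) \<partial>T)"
      by (subst nn_integral_distr) (auto simp: indicator_times)
    also have "\<dots> = (\<integral>\<^sup>+\<omega>. \<integral>\<^sup>+r. ?f (restrict \<omega> {0..<n}, r) \<partial>round_kernel P \<psi> \<eta> \<pi> n (restrict \<omega> {0..<n}) \<partial>T)"
      unfolding T_lim by (rule IT.nn_integral_lim) measurable
    also have "\<dots> = (\<integral>\<^sup>+\<omega>. indicator A (restrict \<omega> {0..<n}) * emeasure P B \<partial>T)"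
    proof (rule nn_integral_cong)
      fix \<omega> assume "\<omega> \<in> space T"
      then have \<omega>: "restrict \<omega> {0..<n} \<in> space ?R" by (rule measurable_space[OF res])
      have sets_K: "sets (round_kernel P \<psi> \<eta> \<pi> n (restrict \<omega> {0..<n})) = sets round_space"
        using measurable_space[OF measurable_round_kernel[OF pi] \<omega>] by (simp add: space_prob_algebra)
      have "(\<lambda>r. indicator B (fst r) :: ennreal) \<in> borel_measurable (round_kernel P \<psi> \<eta> \<pi> n (restrict \<omega> {0..<n}))"
        unfolding measurable_cong_sets[OF sets_K refl] by measurable
      then show "(\<integral>\<^sup>+r. ?f (restrict \<omega> {0..<n}, r) \<partial>round_kernel P \<psi> \<eta> \<pi> n (restrict \<omega> {0..<n}))
          = indicator A (restrict \<omega> {0..<n}) * emeasure P B"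
        using nn_integral_round_kernel_ctx[OF pi \<omega> B] by (simp add: nn_integral_cmult)
    qed
    also have "\<dots> = (\<integral>\<^sup>+\<omega>. indicator A \<omega> \<partial>distr T ?R (\<lambda>\<omega>. restrict \<omega> {0..<n})) * emeasure P B"
      by (simp add: nn_integral_multc nn_integral_distr del: nn_integral_indicator)
    also have "\<dots> = emeasure (distr T ?R (\<lambda>\<omega>. restrict \<omega> {0..<n})) A * emeasure P B" by simp
    finally show "emeasure (distr T ?R (\<lambda>\<omega>. restrict \<omega> {0..<n})) A * emeasure P B =
       emeasure (distr T (?R \<Otimes>\<^sub>M ctx_space) (\<lambda>\<omega>. (restrict \<omega> {0..<n}, fst (\<omega> n)))) (A \<times> B)" by simp
  qed
qed

text \<open>Fubini for the product law of \<open>distr_trajectory\<close>. The bound 1 is tailored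
  to \<open>f\<close> being the indicator that round \<open>n\<close> starts in time.\<close>

lemma integral_trajectory_past_times_ctx:
  fixes f :: "(nat \<Rightarrow> 'd round) \<Rightarrow> real" and m :: "'d ctx \<Rightarrow> real"
  assumes pi: "\<pi> \<in> policies"
    and f[measurable]: "f \<in> borel_measurable (\<Pi>\<^sub>M j\<in>{0..<n}. round_space)"
    and bnd: "\<And>\<omega>. \<bar>f \<omega>\<bar> \<le> 1"
    and m: "integrable P m"
  defines "T \<equiv> trajectory P \<psi> \<eta> \<pi>"
  shows "integrable T (\<lambda>\<omega>. f (restrict \<omega> {0..<n}) * m (fst (\<omega> n)))" (is ?int)
    and "(\<integral>\<omega>. f (restrict \<omega> {0..<n}) * m (fst (\<omega> n)) \<partial>T) = (\<integral>\<omega>. f (restrict \<omega> {0..<n}) \<partial>T) * expectation m" (is ?eq)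
proof -
  interpret T: prob_space T unfolding T_def by (rule prob_space_trajectory[OF pi])
  let ?R = "\<Pi>\<^sub>M j\<in>{0..<n}. (round_space :: 'd round measure)"
  let ?D = "distr T ?R (\<lambda>\<omega>. restrict \<omega> {0..<n})"
  note sT[measurable_cong] = sets_trajectory[OF pi, folded T_def]
  have [measurable]: "m \<in> borel_measurable ctx_space"
    using borel_measurable_integrable[OF m] by (simp add: measurable_cong_sets[OF sets_P refl])
  have res[measurable]: "(\<lambda>\<omega>. restrict \<omega> {0..<n}) \<in> T \<rightarrow>\<^sub>M ?R"
    by (subst measurable_cong_sets[OF sT refl]) (simp add: measurable_restrict_subset)
  have comp[measurable]: "(\<lambda>\<omega>. \<omega> n) \<in> T \<rightarrow>\<^sub>M round_space"
    by (subst measurable_cong_sets[OF sT refl]) simp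
  have pairm: "(\<lambda>\<omega>. (restrict \<omega> {0..<n}, fst (\<omega> n))) \<in> T \<rightarrow>\<^sub>M ?R \<Otimes>\<^sub>M ctx_space"
    by measurable
  have gm: "(\<lambda>(\<omega>, c). f \<omega> * m c) \<in> borel_measurable (?R \<Otimes>\<^sub>M ctx_space)"
    by measurable
  interpret D: prob_space ?D by (rule T.prob_space_distr) simp
  interpret DP: pair_prob_space ?D P by unfold_locales
  have fD: "integrable ?D f"
    by (rule D.integrable_const_bound[where B=1]) (use bnd in auto)
  have prod: "integrable (?D \<Otimes>\<^sub>M P) (\<lambda>(\<omega>, c). f \<omega> * m c)"
  proof (rule DP.Fubini_integrable)
    show "integrable ?D (\<lambda>\<omega>. \<integral>c. norm ((\<lambda>(\<omega>, c). f \<omega> * m c) (\<omega>, c)) \<partial>P)"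
      using fD by (simp add: abs_mult)
  qed (use m in simp_all)
  note dT = distr_trajectory[OF pi, of n, folded T_def]
  show ?int
    using prod integrable_distr_eq[OF pairm gm] unfolding dT[symmetric] by simp
  have "(\<integral>\<omega>. f (restrict \<omega> {0..<n}) * m (fst (\<omega> n)) \<partial>T) = (\<integral>p. (\<lambda>(\<omega>, c). f \<omega> * m c) p \<partial>(?D \<Otimes>\<^sub>M P))"
    unfolding dT[symmetric] by (subst integral_distr[OF pairm gm]) simp
  also have "\<dots> = (\<integral>\<omega>. \<integral>c. f \<omega> * m c \<partial>P \<partial>?D)"
    using DP.integral_fst'[OF prod] by simp
  also have "\<dots> = (\<integral>\<omega>. f \<omega> \<partial>?D) * expectation m" by simp
  also have "\<dots> = (\<integral>\<omega>. f (restrict \<omega> {0..<n}) \<partial>T) * expectation m"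
    by (subst integral_distr) auto
  finally show ?eq .
qed

end

section \<open>Expected reward up to a fixed time\<close>

text \<open>Division by \<open>t\<close> sends the additive constant to 0, and only positive
  \<open>t\<close> matter in the limit.\<close>

lemma
  fixes f :: "real \<Rightarrow> real"
  shows Limsup_le_of_affine_bound: "(\<And>t. 0 \<le> t \<Longrightarrow> f t \<le> \<Gamma> * t + B) \<Longrightarrow> Limsup at_top (\<lambda>t. ereal (f t / t)) \<le> ereal \<Gamma>"
    and Limsup_ge_of_affine_bound: "(\<And>t. 0 \<le> t \<Longrightarrow> \<Gamma> * t - B \<le> f t) \<Longrightarrow> ereal \<Gamma> \<le> Limsup at_top (\<lambda>t. ereal (f t / t))"
proof -
  \<comment> \<open>Stated for a constant of either sign, since it is used with \<open>B\<close>
    above and \<open>- B\<close> below.\<close>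
  have lim: "Limsup at_top (\<lambda>t. ereal (\<Gamma> + C / t)) = ereal \<Gamma>" for C
  proof (rule lim_imp_Limsup)
    have "((\<lambda>t. \<Gamma> + C / t) \<longlongrightarrow> \<Gamma> + 0) at_top"
      by (intro tendsto_add tendsto_const tendsto_divide_0[OF tendsto_const]) (simp add: filterlim_at_top_imp_at_infinity filterlim_ident)
    then show "((\<lambda>t. ereal (\<Gamma> + C / t)) \<longlongrightarrow> ereal \<Gamma>) at_top" by simp
  qed simp
  show "Limsup at_top (\<lambda>t. ereal (f t / t)) \<le> ereal \<Gamma>" if f: "\<And>t. 0 \<le> t \<Longrightarrow> f t \<le> \<Gamma> * t + B"
  proof -
    have "\<forall>\<^sub>F t in at_top. ereal (f t / t) \<le> ereal (\<Gamma> + B / t)"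
      using eventually_gt_at_top[of 0]
      by eventually_elim (use f in \<open>auto simp: field_simps\<close>)
    from Limsup_mono[OF this] show ?thesis by (simp add: lim)
  qed
  show "ereal \<Gamma> \<le> Limsup at_top (\<lambda>t. ereal (f t / t))" if f: "\<And>t. 0 \<le> t \<Longrightarrow> \<Gamma> * t - B \<le> f t"
  proof -
    have "\<forall>\<^sub>F t in at_top. ereal (\<Gamma> + (- B) / t) \<le> ereal (f t / t)"
      using eventually_gt_at_top[of 0]
    proof eventually_elim
      case (elim t)
      then have "\<Gamma> * t - B \<le> f t" using f by simp
      then have "(\<Gamma> * t - B) / t \<le> f t / t" using elim by (intro divide_right_mono) auto
      then show ?case using elim by (simp add: diff_divide_distrib)
    qed
    from Limsup_mono[OF this] show ?thesis by (simp only: lim)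
  qed
qed

section \<open>The greedy policy\<close>

context latency_bandit begin

text \<open>Choosing the first minimizer in a fixed enumeration of all actions makes the choice measurable.\<close>

definition greedy_action :: "real \<Rightarrow> 'd ctx \<Rightarrow> nat set" where
  "greedy_action \<Gamma> c = from_nat_into (Fpow UNIV)
     (LEAST n. from_nat_into (Fpow UNIV) n \<in> actions c \<and>
       g_fun \<Gamma> (from_nat_into (Fpow UNIV) n) (latency c) (mean_reward \<psi> c) = min_g \<psi> \<Gamma> c)"

definition greedy_policy :: "real \<Rightarrow> 'd policy" where
  "greedy_policy \<Gamma> = (\<lambda>k h c. return action_space (greedy_action \<Gamma> c))"

lemma from_nat_into_Fpow: "from_nat_into (Fpow UNIV) n \<in> Fpow (UNIV :: nat set)"
  by (rule from_nat_into) (auto simp: Fpow_def)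

text \<open>Every available action is a finite set of naturals, so a minimizer occurs in the
  enumeration and the least index exists.\<close>

lemma greedy_action:
  assumes "c \<in> space ctx_space"
  shows "greedy_action \<Gamma> c \<in> actions c"
    and "g_fun \<Gamma> (greedy_action \<Gamma> c) (latency c) (mean_reward \<psi> c) = min_g \<psi> \<Gamma> c"
proof -
  let ?Q = "\<lambda>n. from_nat_into (Fpow UNIV) n \<in> actions c \<and>
    g_fun \<Gamma> (from_nat_into (Fpow UNIV) n) (latency c) (mean_reward \<psi> c) = min_g \<psi> \<Gamma> c"
  obtain A where A: "A \<in> actions c" "g_fun \<Gamma> A (latency c) (mean_reward \<psi> c) = min_g \<psi> \<Gamma> c"
    using min_g_attained[OF assms] by blast
  have "A \<in> Fpow UNIV" using A actions_ctx_space(3)[OF assms] by auto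
  then obtain n where "from_nat_into (Fpow UNIV) n = A"
    using from_nat_into_surj[of "Fpow (UNIV :: nat set)" A] by (auto simp: countable_Fpow)
  then have "?Q n" using A by simp
  then have "?Q (LEAST n. ?Q n)" by (rule LeastI)
  then show "greedy_action \<Gamma> c \<in> actions c"
    "g_fun \<Gamma> (greedy_action \<Gamma> c) (latency c) (mean_reward \<psi> c) = min_g \<psi> \<Gamma> c"
    unfolding greedy_action_def by auto
qed

lemma measurable_g_fun_fixed:
  assumes "A \<in> Fpow UNIV"
  shows "(\<lambda>c. g_fun \<Gamma> A (latency c) (mean_reward \<psi> c)) \<in> borel_measurable ctx_space"
proof -
  have [measurable]: "(\<lambda>c :: 'd ctx. latency c A) \<in> borel_measurable ctx_space"
    by (rule measurable_latency_fixed[OF assms])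
  show ?thesis unfolding g_fun_def by measurable
qed

lemma measurable_greedy_action: "greedy_action \<Gamma> \<in> ctx_space \<rightarrow>\<^sub>M action_space"
proof -
  have [measurable]: "Measurable.pred ctx_space (\<lambda>c. from_nat_into (Fpow UNIV) n \<in> actions c \<and>
      g_fun \<Gamma> (from_nat_into (Fpow UNIV) n) (latency c) (mean_reward \<psi> c) = min_g \<psi> \<Gamma> c)" for n
  proof -
    have [measurable]: "(\<lambda>c :: 'd ctx. from_nat_into (Fpow UNIV) n) \<in> ctx_space \<rightarrow>\<^sub>M action_space"
      by (rule measurable_const) (simp add: from_nat_into_Fpow)
    note measurable_g_fun_fixed[OF from_nat_into_Fpow, measurable]
    show ?thesis by measurable
  qed
  \<comment> \<open>The least index depends measurably on the context, and any map out of the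
    discrete naturals into the action space is measurable.\<close>
  have "from_nat_into (Fpow UNIV) \<in> count_space UNIV \<rightarrow>\<^sub>M action_space"
    by (simp add: from_nat_into_Fpow)
  then show ?thesis
    unfolding greedy_action_def by (rule measurable_compose[rotated]) measurable
qed

lemma greedy_policy_in_policies: "greedy_policy \<Gamma> \<in> policies"
  unfolding policies_def greedy_policy_def
proof (intro CollectI conjI allI ballI)
  show "(\<lambda>(h, c). return action_space (greedy_action \<Gamma> c)) \<in> history_space k \<Otimes>\<^sub>M ctx_space \<rightarrow>\<^sub>M prob_algebra action_space" for k
    unfolding split_beta'
    by (rule measurable_compose[OF _ measurable_return_prob_space])
       (rule measurable_compose[OF measurable_snd measurable_greedy_action])
  show "AE A in return action_space (greedy_action \<Gamma> c). A \<in> actions c"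
    if "c \<in> space ctx_space" for k and h :: "nat \<Rightarrow> 'd obs" and c
    using greedy_action(1)[OF that] measurable_space[OF measurable_greedy_action that]
    by (subst AE_return) (auto simp: action_space_def)
qed

section \<open>Comparison of the reward with the minimum of \<open>g\<close>\<close>

lemma round_g: "\<Gamma> * round_latency r - round_reward \<psi> r = g_fun \<Gamma> (fst (snd r)) (latency (fst r)) (mean_reward \<psi> (fst r))"
  by (simp add: g_fun_def round_latency_def round_reward_def split_beta' mult.commute)

lemma AE_min_g_le:
  assumes pi: "\<pi> \<in> policies"
  shows "AE \<omega> in trajectory P \<psi> \<eta> \<pi>. \<forall>j. min_g \<psi> \<Gamma> (fst (\<omega> j)) \<le> \<Gamma> * round_latency (\<omega> j) - round_reward \<psi> (\<omega> j)"
  using AE_trajectory_regular[OF pi] AE_space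
proof eventually_elim
  case (elim \<omega>)
  have "fst (\<omega> j) \<in> space ctx_space" for j
    using elim(2) sets_eq_imp_space_eq[OF sets_trajectory[OF pi]]
    by (intro space_round_space) (auto simp: space_PiM)
  then show ?case unfolding round_g using elim(1) by (blast intro: min_g_le)
qed

text \<open>The greedy policy puts all its mass on a minimizer whatever the history, so
  \<open>AE_trajectory\<close> applies with the equality itself as the property.\<close>

lemma AE_greedy_min_g:
  "AE \<omega> in trajectory P \<psi> \<eta> (greedy_policy \<Gamma>).
     \<forall>j. \<Gamma> * round_latency (\<omega> j) - round_reward \<psi> (\<omega> j) = min_g \<psi> \<Gamma> (fst (\<omega> j))"
proof -
  have [measurable]: "(\<lambda>p :: 'd ctx \<times> nat set. g_fun \<Gamma> (snd p) (latency (fst p)) (mean_reward \<psi> (fst p)))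
      \<in> borel_measurable (ctx_space \<Otimes>\<^sub>M action_space)"
    by (rule measurable_compose_countable'[where I="Fpow UNIV" and g=snd])
       (auto simp: countable_Fpow action_space_def intro!: measurable_compose[OF measurable_fst measurable_g_fun_fixed])
  have "AE \<omega> in trajectory P \<psi> \<eta> (greedy_policy \<Gamma>).
     \<forall>j. g_fun \<Gamma> (fst (snd (\<omega> j))) (latency (fst (\<omega> j))) (mean_reward \<psi> (fst (\<omega> j))) = min_g \<psi> \<Gamma> (fst (\<omega> j))"
  proof (rule AE_trajectory[OF greedy_policy_in_policies])
    show "Measurable.pred (ctx_space \<Otimes>\<^sub>M action_space) (\<lambda>p :: 'd ctx \<times> nat set.
        g_fun \<Gamma> (snd p) (latency (fst p)) (mean_reward \<psi> (fst p)) = min_g \<psi> \<Gamma> (fst p))"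
      by measurable
    show "AE c in P. AE A in greedy_policy \<Gamma> k h c. g_fun \<Gamma> A (latency c) (mean_reward \<psi> c) = min_g \<psi> \<Gamma> c" for k h
    proof (rule AE_I2)
      fix c assume "c \<in> space P"
      then have c: "c \<in> space ctx_space" by (simp add: space_P)
      show "AE A in greedy_policy \<Gamma> k h c. g_fun \<Gamma> A (latency c) (mean_reward \<psi> c) = min_g \<psi> \<Gamma> c"
        unfolding greedy_policy_def
        using greedy_action(2)[OF c] measurable_space[OF measurable_greedy_action c]
        by (subst AE_return) (auto simp: action_space_def)
    qed
  qed
  then show ?thesis by (simp add: round_g)
qed

text \<open>Here \<Gamma> is arbitrary: the root serves for the expectation bounds, and the value 0
  for integrability.\<close>

lemma cumulative_reward_deviation:
  assumes pi: "\<pi> \<in> policies" and t: "0 \<le> t" "t < real N * l_min"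
  shows "AE \<omega> in trajectory P \<psi> \<eta> \<pi>.
    \<bar>(\<Sum>j<N. if (\<Sum>i<j. round_latency (\<omega> i)) \<le> t then \<Gamma> * round_latency (\<omega> j) - round_reward \<psi> (\<omega> j) else 0)
      - (\<Gamma> * t - cumulative_reward \<psi> \<omega> t)\<bar> \<le> \<bar>\<Gamma>\<bar> * l_max + n_max"
  using AE_trajectory_regular[OF pi]
proof eventually_elim
  case (elim \<omega>)
  show ?case unfolding cumulative_reward_def rounds_completed_def
    by (rule stopped_sum_bound[OF bounds_pos(2)]) (use elim t in auto)
qed

lemma integrable_cumulative_reward:
  assumes pi: "\<pi> \<in> policies" and t: "0 \<le> t"
  shows "integrable (trajectory P \<psi> \<eta> \<pi>) (\<lambda>\<omega>. cumulative_reward \<psi> \<omega> t)"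
proof -
  let ?T = "trajectory P \<psi> \<eta> \<pi>"
  interpret T: prob_space ?T by (rule prob_space_trajectory[OF pi])
  note sT[measurable_cong] = sets_trajectory[OF pi]
  obtain N :: nat where N: "t < real N * l_min"
    using reals_Archimedean3[OF bounds_pos(2)] by blast
  show ?thesis
  \<comment> \<open>With \<Gamma> = 0 the deviation bound compares the reward with a stopped sum of
    at most \<open>N\<close> round rewards. The sum contributes \<open>N * n_max\<close>, the round
    in progress one more \<open>n_max\<close>.\<close>
  proof (rule T.integrable_const_bound[where B="real N * n_max + n_max"])
    show "AE \<omega> in ?T. norm (cumulative_reward \<psi> \<omega> t) \<le> real N * n_max + n_max"
      using cumulative_reward_deviation[OF pi t N, of 0] AE_trajectory_regular[OF pi]
    proof eventually_elim
      case (elim \<omega>)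
      have "\<bar>\<Sum>j<N. if (\<Sum>i<j. round_latency (\<omega> i)) \<le> t then 0 * round_latency (\<omega> j) - round_reward \<psi> (\<omega> j) else 0\<bar>
          \<le> (\<Sum>j<N. real n_max)"
        using elim(2) by (intro order.trans[OF sum_abs] sum_mono) auto
      then show ?case using elim(1) by simp
    qed
  qed measurable
qed

text \<open>A form of Wald's identity. Whether round \<open>j\<close> starts by time
  \<open>t\<close> is decided by earlier rounds, so each term factors into the probability of that
  event and the expectation of \<open>min_g\<close>, which is 0 at a root. The deterministic cap
  \<open>N\<close> reduces the claim to linearity of a finite sum.\<close>

lemma stopped_min_g_sum:
  assumes pi: "\<pi> \<in> policies" and root: "expectation (min_g \<psi> \<Gamma>) = 0"
  defines "T \<equiv> trajectory P \<psi> \<eta> \<pi>"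
  shows "integrable T (\<lambda>\<omega>. \<Sum>j<N. if (\<Sum>i<j. round_latency (\<omega> i)) \<le> t then min_g \<psi> \<Gamma> (fst (\<omega> j)) else 0)" (is "integrable T (\<lambda>\<omega>. sum (?d \<omega>) _)")
    and "(\<integral>\<omega>. (\<Sum>j<N. if (\<Sum>i<j. round_latency (\<omega> i)) \<le> t then min_g \<psi> \<Gamma> (fst (\<omega> j)) else 0) \<partial>T) = 0"
proof -
  have *: "integrable T (\<lambda>\<omega>. ?d \<omega> j) \<and> (\<integral>\<omega>. ?d \<omega> j \<partial>T) = 0" for j
  proof -
    let ?f = "\<lambda>\<omega> :: nat \<Rightarrow> 'd round. if (\<Sum>i<j. round_latency (\<omega> i)) \<le> t then 1 else 0 :: real"
    have lat: "(\<lambda>\<omega> :: nat \<Rightarrow> 'd round. \<Sum>i<j. round_latency (\<omega> i)) \<in> borel_measurable (\<Pi>\<^sub>M j\<in>{0..<j}. round_space)"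
    proof (intro borel_measurable_sum)
      fix i assume "i \<in> {..<j}"
      then have "(\<lambda>\<omega> :: nat \<Rightarrow> 'd round. \<omega> i) \<in> (\<Pi>\<^sub>M j\<in>{0..<j}. round_space) \<rightarrow>\<^sub>M round_space"
        by (intro measurable_component_singleton) simp
      from measurable_compose[OF this measurable_round_latency]
      show "(\<lambda>\<omega> :: nat \<Rightarrow> 'd round. round_latency (\<omega> i)) \<in> borel_measurable (\<Pi>\<^sub>M j\<in>{0..<j}. round_space)" .
    qed
    have f: "?f \<in> borel_measurable (\<Pi>\<^sub>M j\<in>{0..<j}. round_space)"
      using lat by measurable
    \<comment> \<open>The starting time of round \<open>j\<close> sums latencies over
      \<open>i < j\<close> only, so restricting the trajectory to \<open>{0..<j}\<close> does not
      change it.\<close>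
    have "(\<lambda>\<omega>. ?d \<omega> j) = (\<lambda>\<omega>. ?f (restrict \<omega> {0..<j}) * min_g \<psi> \<Gamma> (fst (\<omega> j)))"
      by (auto simp: fun_eq_iff)
    then show ?thesis
      using integral_trajectory_past_times_ctx[OF pi f _ integrable_min_g_ctx[of \<Gamma>]] root
      by (simp add: T_def)
  qed
  then show "integrable T (\<lambda>\<omega>. sum (?d \<omega>) {..<N})" "(\<integral>\<omega>. sum (?d \<omega>) {..<N} \<partial>T) = 0"
    by auto
qed

section \<open>Affine bounds on the expected reward\<close>

text \<open>Adding the stopped sum \<open>D\<close>, whose mean is 0, leaves the expectation
  unchanged and gives a quantity that is bounded almost surely. The remainder depends neither on
  \<open>t\<close> nor on the policy.\<close>

lemma expected_cumulative_reward_le: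
  assumes pi: "\<pi> \<in> policies" and root: "expectation (min_g \<psi> \<Gamma>) = 0" and t: "0 \<le> t"
  shows "(\<integral>\<omega>. cumulative_reward \<psi> \<omega> t \<partial>trajectory P \<psi> \<eta> \<pi>) \<le> \<Gamma> * t + (\<bar>\<Gamma>\<bar> * l_max + n_max)"
proof -
  let ?T = "trajectory P \<psi> \<eta> \<pi>"
  interpret T: prob_space ?T by (rule prob_space_trajectory[OF pi])
  obtain N :: nat where N: "t < real N * l_min"
    using reals_Archimedean3[OF bounds_pos(2)] by blast
  define D where "D \<omega> = (\<Sum>j<N. if (\<Sum>i<j. round_latency (\<omega> i)) \<le> t then min_g \<psi> \<Gamma> (fst (\<omega> j)) else 0)"
    for \<omega> :: "nat \<Rightarrow> 'd round"
  note D = stopped_min_g_sum[OF pi root, where N=N and t=t, folded D_def]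
  note q = integrable_cumulative_reward[OF pi t]
  have "AE \<omega> in ?T. cumulative_reward \<psi> \<omega> t + D \<omega> \<le> \<Gamma> * t + (\<bar>\<Gamma>\<bar> * l_max + n_max)"
    using cumulative_reward_deviation[OF pi t N, of \<Gamma>] AE_min_g_le[OF pi, of \<Gamma>]
  proof eventually_elim
    case (elim \<omega>)
    have "D \<omega> \<le> (\<Sum>j<N. if (\<Sum>i<j. round_latency (\<omega> i)) \<le> t then \<Gamma> * round_latency (\<omega> j) - round_reward \<psi> (\<omega> j) else 0)"
      unfolding D_def using elim(2) by (intro sum_mono) auto
    then show ?case using elim(1) by linarith
  qed
  then have "(\<integral>\<omega>. cumulative_reward \<psi> \<omega> t + D \<omega> \<partial>?T) \<le> \<Gamma> * t + (\<bar>\<Gamma>\<bar> * l_max + n_max)"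
    using q D(1) by (intro T.integral_le_const) auto
  then show ?thesis using q D by simp
qed

text \<open>For the greedy policy the summands of \<open>D\<close> equal those of the stopped sum,
  so the other side of the deviation bound becomes available.\<close>

lemma expected_cumulative_reward_greedy_ge:
  assumes root: "expectation (min_g \<psi> \<Gamma>) = 0" and t: "0 \<le> t"
  shows "\<Gamma> * t - (\<bar>\<Gamma>\<bar> * l_max + n_max) \<le> (\<integral>\<omega>. cumulative_reward \<psi> \<omega> t \<partial>trajectory P \<psi> \<eta> (greedy_policy \<Gamma>))"
proof -
  let ?T = "trajectory P \<psi> \<eta> (greedy_policy \<Gamma>)"
  note pi = greedy_policy_in_policies[of \<Gamma>]
  interpret T: prob_space ?T by (rule prob_space_trajectory[OF pi])
  obtain N :: nat where N: "t < real N * l_min"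
    using reals_Archimedean3[OF bounds_pos(2)] by blast
  define D where "D \<omega> = (\<Sum>j<N. if (\<Sum>i<j. round_latency (\<omega> i)) \<le> t then min_g \<psi> \<Gamma> (fst (\<omega> j)) else 0)"
    for \<omega> :: "nat \<Rightarrow> 'd round"
  note D = stopped_min_g_sum[OF pi root, where N=N and t=t, folded D_def]
  note q = integrable_cumulative_reward[OF pi t]
  have "AE \<omega> in ?T. \<Gamma> * t - (\<bar>\<Gamma>\<bar> * l_max + n_max) \<le> cumulative_reward \<psi> \<omega> t + D \<omega>"
    using cumulative_reward_deviation[OF pi t N, of \<Gamma>] AE_greedy_min_g[of \<Gamma>]
  proof eventually_elim
    case (elim \<omega>)
    have "D \<omega> = (\<Sum>j<N. if (\<Sum>i<j. round_latency (\<omega> i)) \<le> t then \<Gamma> * round_latency (\<omega> j) - round_reward \<psi> (\<omega> j) else 0)"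
      unfolding D_def by (simp only: spec[OF elim(2)])
    then show ?case using elim(1) by linarith
  qed
  then have "\<Gamma> * t - (\<bar>\<Gamma>\<bar> * l_max + n_max) \<le> (\<integral>\<omega>. cumulative_reward \<psi> \<omega> t + D \<omega> \<partial>?T)"
    using q D(1) by (intro T.integral_ge_const) auto
  then show ?thesis using q D by simp
qed

text \<open>The upper bound holds for each policy separately, hence for the supremum; the greedy
  policy lies in \<open>policies\<close> and attains it.\<close>

lemma optimal_average_reward_eq_root:
  assumes root: "expectation (min_g \<psi> \<Gamma>) = 0"
  shows "optimal_average_reward P \<psi> \<eta> = ereal \<Gamma>"
proof (rule antisym)
  show "optimal_average_reward P \<psi> \<eta> \<le> ereal \<Gamma>"
    unfolding optimal_average_reward_def average_reward_def
    by (intro SUP_least Limsup_le_of_affine_bound[OF expected_cumulative_reward_le[OF _ root]])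
  have "ereal \<Gamma> \<le> average_reward P \<psi> \<eta> (greedy_policy \<Gamma>)"
    unfolding average_reward_def
    by (rule Limsup_ge_of_affine_bound[OF expected_cumulative_reward_greedy_ge[OF root]])
  also have "\<dots> \<le> optimal_average_reward P \<psi> \<eta>"
    unfolding optimal_average_reward_def by (intro SUP_upper greedy_policy_in_policies)
  finally show "ereal \<Gamma> \<le> optimal_average_reward P \<psi> \<eta>" .
qed

end

theorem theorem1:
  fixes P :: "'d::finite ctx measure"
    and \<psi> :: "real^'d \<Rightarrow> real"
    and \<eta> :: "'d noise"
    and n_max :: nat
    and l_min l_max :: real
  assumes "latency_bandit P \<psi> \<eta> n_max l_min l_max"
  shows "\<exists>\<Gamma>::real. optimal_average_reward P \<psi> \<eta> = ereal \<Gamma> \<and>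
    (\<forall>\<Gamma>'::real. (\<integral>c. (MIN A\<in>actions c. g_fun \<Gamma>' A (latency c) (mean_reward \<psi> c)) \<partial>P) = 0 \<longleftrightarrow> \<Gamma>' = \<Gamma>)"
proof -
  interpret latency_bandit P \<psi> \<eta> n_max l_min l_max by fact
  obtain \<Gamma> where "\<And>\<Gamma>'. expectation (min_g \<psi> \<Gamma>') = 0 \<longleftrightarrow> \<Gamma>' = \<Gamma>"
    using ex1_root by blast
  with optimal_average_reward_eq_root[of \<Gamma>] show ?thesis
    unfolding min_g_def[abs_def] by blast
qed

end
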